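(* Let $T>0$, $\alpha>1$, and let $f$ be the Bessel kernel $$f(x)=\int_0^\infty w^{\frac{\alpha-5}{2}}e^{-w}e^{-\frac{|x|^2}{4w}}\,dw,\qquad x\in\mathbb{R}^3.$$ Then $\int_{|x|\le1}\frac{f(x)}{|x|}dx<\infty$, and for any $\gamma,\rho_1,\nu$ with $0<\gamma,\rho_1,\nu<\min(\alpha-1,1)$ and any $\gamma',\rho_2$ with $0<\gamma',\rho_2<\min(\alpha-1,2)$ there is a constant $C$ such that: (i) for all $y\in\mathbb{R}^3$, $\int_{|z|\le2T}\frac{|f(z+y)-f(z)|}{|z|}dz\le C|y|^{\gamma}$; (ii) for all $y\in\mathbb{R}^3$, $\int_{|z|\le2T}\frac{|f(z+y)+f(z-y)-2f(z)|}{|z|}dz\le C|y|^{\gamma'}$; (iii) for all $0<h\le2T$, $\int_{|z|\le h}\frac{f(z)}{|z|}dz\le Ch^{\nu}$; (iv) for all $0<h\le1$, $$\int_0^T\int_{S^2}\int_{S^2}\left|f\big(s(\xi+\eta)+h(\xi+\eta)\big)-f\big(s(\xi+\eta)+h\eta\big)\right|s\,\sigma(d\xi)\sigma(d\eta)\,ds\le Ch^{\rho_1};$$ (v) for all $0<h\le1$, $$\int_0^T\int_{S^2}\int_{S^2}\Big|f\big(s(\xi+\eta)+h(\xi+\eta)\big)-f\big(s(\xi+\eta)+h\xi\big)-f\big(s(\xi+\eta)+h\eta\big)+f\big(s(\xi+\eta)\big)\Big|s^2\,\sigma(d\xi)\sigma(d\eta)\,ds\le Ch^{\rho_2}.$$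
   Context: $S^2$ is the unit sphere in $\mathbb{R}^3$ and $\sigma(d\xi)$ the uniform surface measure on it. *)

theory Defs
  imports "HOL-Analysis.Analysis"
begin

(* The integral converges for every x \<noteq> 0, and for x = 0 iff \<alpha> > 3.  For \<alpha> \<le> 3 the kernel
   is infinite at the origin, whereas the Bochner integral returns the default value 0 there. *)
definition bessel_kernel :: "real \<Rightarrow> real^3 \<Rightarrow> real" where
  "bessel_kernel \<alpha> x =
     (LINT w:{0<..}|lborel. w powr ((\<alpha> - 5) / 2) * exp (- w) * exp (- ((norm x)\<^sup>2 / (4 * w))))"

(* Surface measure as cone measure: the area of A \<subseteq> S^2 is 3 times the volume of the cone
   {r *\<^sub>R \<xi> | \<xi> \<in> A, 0 < r < 1}; sgn is the radial projection x / norm x.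
   The measure is unnormalised, with total mass 4 * pi. *)
definition sphere_measure :: "(real^3) measure" where
  "sphere_measure =
     scale_measure 3
       (distr (restrict_space lborel (ball 0 1 - {0})) (restrict_space borel (sphere 0 1)) sgn)"

lemma emeasure_sphere_measure: "emeasure sphere_measure (sphere 0 1) = ennreal (4 * pi)"
proof -
  have m: "sgn \<in> restrict_space lborel (ball 0 1 - {0 :: real^3}) \<rightarrow>\<^sub>M restrict_space borel (sphere 0 1)"
    by (rule measurable_restrict_space3) (auto simp: norm_sgn sgn_div_norm[abs_def])
  have "sgn -` sphere 0 1 \<inter> (ball 0 1 - {0 :: real^3}) = ball 0 1 - {0}"
    by (auto simp: norm_sgn)
  moreover have "emeasure lborel (ball 0 1 - {0 :: real^3}) = emeasure lborel (ball (0 :: real^3) 1)"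
    by (subst emeasure_Diff) auto
  moreover have "\<dots> = ennreal (4 / 3 * pi)"
    by (simp add: emeasure_ball unit_ball_vol_3)
  moreover have "sphere 0 1 \<in> sets (restrict_space borel (sphere (0 :: real^3) 1))"
    by (auto simp: sets_restrict_space)
  ultimately have "emeasure sphere_measure (sphere 0 1) = 3 * ennreal (4 / 3 * pi)"
    by (simp add: sphere_measure_def emeasure_distr[OF m] space_restrict_space emeasure_restrict_space)
  also have "\<dots> = ennreal (4 * pi)"
    by (simp flip: ennreal_numeral ennreal_mult)
  finally show ?thesis .
qed

end

theory Submission
  imports Defs "HOL-Probability.Distributions"
begin

text \<open>
  The kernel is a mixture of the Gaussians \<open>exp (- a * (norm x)\<^sup>2)\<close>, \<open>a = 1 / (4 * w)\<close>, with weight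
  \<open>w powr ((\<alpha> - 5) / 2) * exp (- w)\<close>, so by Tonelli it suffices to bound each quantity for one
  Gaussian by a multiple of \<open>d powr \<gamma> * w powr p\<close> with \<open>p + (\<alpha> - 5) / 2 > -1\<close>; the integral in \<open>w\<close> is
  then a Gamma integral.  A first (second) difference with step \<open>d\<close> is bounded by
  \<open>min 1 (sqrt a * d)\<close> (respectively its square) times wider Gaussians, and the minimum is at most
  \<open>(sqrt a * d) powr \<gamma>\<close>.  The wider Gaussians integrate against \<open>1 / norm z\<close> to a multiple of \<open>1 / a\<close>.

  All points in the sphere integrals have norms that depend only on \<open>q = (norm (\<xi> + \<eta>))\<^sup>2\<close>, and
  \<open>exp (- c * q)\<close> integrates over \<open>\<xi>\<close> to at most a multiple of \<open>min 1 (1 / c) \<le> c powr (- \<theta>)\<close>, where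
  \<open>c = a * s\<^sup>2 / 2\<close>.  Taking \<open>\<theta> < 1\<close> avoids a logarithmic divergence in \<open>s\<close> and costs an
  arbitrarily small power of \<open>w\<close>.
\<close>

section \<open>Gaussian integrals\<close>

lemma nn_integral_gaussian:
  assumes "0 < a"
  shows "(\<integral>\<^sup>+x. ennreal (exp (- (a * x\<^sup>2))) \<partial>lborel) = ennreal (sqrt (pi / a))"
proof -
  define \<sigma> where "\<sigma> = sqrt (1 / (2 * a))"
  have \<sigma>: "\<sigma> > 0" "\<sigma>\<^sup>2 = 1 / (2 * a)"
    using assms by (auto simp: \<sigma>_def)
  have "exp (- (a * x\<^sup>2)) = sqrt (pi / a) * normal_density 0 \<sigma> x" for x
    using assms by (simp add: normal_density_def \<sigma> real_sqrt_divide)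
  then have "(\<integral>\<^sup>+x. ennreal (exp (- (a * x\<^sup>2))) \<partial>lborel) =
      ennreal (sqrt (pi / a)) * (\<integral>\<^sup>+x. ennreal (normal_density 0 \<sigma> x) \<partial>lborel)"
    using assms by (simp add: ennreal_mult nn_integral_cmult)
  also have "(\<integral>\<^sup>+x. ennreal (normal_density 0 \<sigma> x) \<partial>lborel) = 1"
    using \<sigma> by (subst nn_integral_eq_integral) auto
  finally show ?thesis by simp
qed

text \<open>Reflection exchanges the two half-lines, so each carries half of the full integral; the
  shared point 0 is null.\<close>

lemma nn_integral_gaussian_atLeast_0:
  assumes "0 < a"
  shows "(\<integral>\<^sup>+x\<in>{0..}. ennreal (exp (- (a * x\<^sup>2))) \<partial>lborel) = ennreal (sqrt (pi / a) / 2)"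
proof -
  let ?g = "\<lambda>x::real. ennreal (exp (- (a * x\<^sup>2)))"
  have *: "(\<integral>\<^sup>+x\<in>{0..}. ?g x \<partial>lborel) = (\<integral>\<^sup>+x\<in>{..0}. ?g x \<partial>lborel)"
    by (subst nn_integral_real_affine[where c="-1" and t=0])
       (auto intro!: nn_integral_cong simp: indicator_def)
  have "ennreal (sqrt (pi / a)) = (\<integral>\<^sup>+x. ?g x \<partial>lborel)"
    using assms by (simp add: nn_integral_gaussian)
  also have "\<dots> = (\<integral>\<^sup>+x. ?g x * indicator {0..} x + ?g x * indicator {..0} x \<partial>lborel)"
    by (intro nn_integral_cong_AE eventually_mono[OF AE_lborel_singleton[of 0]])
       (auto simp: indicator_def)
  also have "\<dots> = 2 * (\<integral>\<^sup>+x\<in>{0..}. ?g x \<partial>lborel)"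
    by (subst nn_integral_add) (auto simp: * mult_2)
  finally have **: "2 * (\<integral>\<^sup>+x\<in>{0..}. ?g x \<partial>lborel) = ennreal (sqrt (pi / a))" ..
  \<comment> \<open>Finiteness has to be known first, since in \<open>ennreal\<close> the factor 2
    cannot be cancelled at infinity.\<close>
  then have "(\<integral>\<^sup>+x\<in>{0..}. ?g x \<partial>lborel) \<noteq> \<infinity>"
    by (auto simp: ennreal_mult_eq_top_iff)
  then obtain r where r: "0 \<le> r" "(\<integral>\<^sup>+x\<in>{0..}. ?g x \<partial>lborel) = ennreal r"
    by (cases "(\<integral>\<^sup>+x\<in>{0..}. ?g x \<partial>lborel)") auto
  have "2 * r = sqrt (pi / a)"
    using ** r assms by (simp add: ennreal_mult' flip: ennreal_numeral)
       (metis (no_types, lifting) divide_nonneg_pos ennreal_inj ennreal_mult' mult_nonneg_nonneg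
          pi_ge_zero real_sqrt_ge_zero zero_le_numeral)
  with r show ?thesis by (metis nonzero_mult_div_cancel_left zero_neq_numeral)
qed

text \<open>The squared norm is the sum of the squared coordinates, so the Gaussian is a product
  over \<open>Basis\<close> and the integral factorises.\<close>

lemma nn_integral_gaussian_euclidean:
  assumes "0 < a"
  shows "(\<integral>\<^sup>+(x::'a::euclidean_space). ennreal (exp (- (a * (norm x)\<^sup>2))) \<partial>lborel)
    = ennreal (sqrt (pi / a) ^ DIM('a))"
proof -
  have "exp (- (a * (norm x)\<^sup>2)) = (\<Prod>b\<in>Basis. exp (- (a * (x \<bullet> b)\<^sup>2)))" for x :: 'a
    by (simp add: exp_sum[symmetric] sum_negf sum_distrib_left[symmetric] norm_eq_sqrt_inner
          euclidean_inner[of x x] power2_eq_square[symmetric] sum_nonneg)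
  then have "(\<integral>\<^sup>+(x::'a). ennreal (exp (- (a * (norm x)\<^sup>2))) \<partial>lborel) =
      (\<integral>\<^sup>+(x::'a). (\<Prod>b\<in>Basis. ennreal (exp (- (a * (x \<bullet> b)\<^sup>2)))) \<partial>lborel)"
    by (simp add: prod_ennreal)
  also have "\<dots> = (\<Prod>b\<in>(Basis::'a set). ennreal (sqrt (pi / a)))"
    using assms by (subst nn_integral_lborel_prod) (auto simp: nn_integral_gaussian)
  finally show ?thesis
    using assms by (simp add: ennreal_power)
qed

section \<open>Gaussians against the weight \<open>1 / norm z\<close> in dimension three\<close>

lemma nn_integral_lborel_shift:
  fixes f :: "'a::euclidean_space \<Rightarrow> ennreal"
  assumes [measurable]: "f \<in> borel_measurable borel"
  shows "(\<integral>\<^sup>+x. f (x + c) \<partial>lborel) = (\<integral>\<^sup>+x. f x \<partial>lborel)"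
  by (subst (2) lborel_distr_plus[of c, symmetric]) (simp add: nn_integral_distr add.commute)

text \<open>Up to a constant the integrand is the mass of a three-dimensional Gaussian with
  parameter \<open>a + v\<^sup>2\<close>, as needed when \<open>1 / norm x\<close> is written as a
  mixture of Gaussians. The antiderivative \<open>v / (a * sqrt (a + v\<^sup>2))\<close> tends to
  \<open>1 / a\<close>.\<close>

lemma nn_integral_powr_minus_three_halves:
  assumes "0 < a"
  shows "(\<integral>\<^sup>+v\<in>{0..}. ennreal (1 / sqrt (a + v\<^sup>2) ^ 3) \<partial>lborel) = ennreal (1 / a)"
proof -
  let ?F = "\<lambda>v. v / (a * sqrt (a + v\<^sup>2))"
  have "(\<integral>\<^sup>+v\<in>{0..}. ennreal (1 / sqrt (a + v\<^sup>2) ^ 3) \<partial>lborel) = ennreal (1 / a - ?F 0)"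
  proof (rule nn_integral_FTC_atLeast)
    fix v :: real
    let ?s = "sqrt (a + v\<^sup>2)"
    have p: "a + v\<^sup>2 > 0" using assms by (simp add: add_pos_nonneg)
    then have s: "sqrt (a + v\<^sup>2) > 0" "sqrt (a + v\<^sup>2) * sqrt (a + v\<^sup>2) = a + v\<^sup>2" by auto
    show "DERIV ?F v :> 1 / sqrt (a + v\<^sup>2) ^ 3"
    proof (rule DERIV_cong)
      show "DERIV ?F v :> (1 * (a * ?s) - v * (a * (2 * v * (inverse ?s / 2)))) / (a * ?s * (a * ?s))"
        using p assms by (auto intro!: derivative_eq_intros)
      have "(1 * (a * r) - v * (a * (2 * v * (inverse r / 2)))) / (a * r * (a * r))
          = (r * r - v\<^sup>2) / (a * r ^ 3)" if "r > 0" for r :: real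
        using that assms by (simp add: field_simps power2_eq_square power3_eq_cube)
      from this[OF s(1)] have "(1 * (a * ?s) - v * (a * (2 * v * (inverse ?s / 2)))) / (a * ?s * (a * ?s))
          = (a + v\<^sup>2 - v\<^sup>2) / (a * ?s ^ 3)"
        unfolding s(2) .
      also have "\<dots> = 1 / ?s ^ 3"
        using assms by simp
      finally show "(1 * (a * ?s) - v * (a * (2 * v * (inverse ?s / 2)))) / (a * ?s * (a * ?s)) = 1 / ?s ^ 3" .
    qed
  next
    have "((\<lambda>v. 1 / (a * sqrt (a / v\<^sup>2 + 1))) \<longlongrightarrow> 1 / (a * sqrt (0 + 1))) at_top"
      using assms by (intro tendsto_intros tendsto_divide_0[OF tendsto_const] filterlim_at_top_imp_at_infinity
            filterlim_pow_at_top filterlim_ident) auto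
    moreover have "\<forall>\<^sub>F v in at_top. 1 / (a * sqrt (a / v\<^sup>2 + 1)) = ?F v"
      using eventually_gt_at_top[of 0]
    proof eventually_elim
      case (elim v)
      have "sqrt (a / v\<^sup>2 + 1) = sqrt (a + v\<^sup>2) / v"
      proof -
        have "a / v\<^sup>2 + 1 = (a + v\<^sup>2) / v\<^sup>2"
          using elim by (simp add: field_simps)
        then show ?thesis using elim by (simp add: real_sqrt_divide)
      qed
      then show ?case using elim by simp
    qed
    ultimately show "(?F \<longlongrightarrow> 1 / a) at_top"
      by (auto elim: Lim_transform_eventually)
  qed (use assms in auto)
  then show ?thesis by simp
qed


lemma nn_integral_gaussian_over_norm:
  assumes "0 < a"
  shows "(\<integral>\<^sup>+(x::real^3). ennreal (exp (- (a * (norm x)\<^sup>2)) / norm x) \<partial>lborel) = ennreal (2 * pi / a)"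
proof -
  \<comment> \<open>subordination: \<open>1 / norm x\<close> is itself an integral of the Gaussians \<open>exp (- v\<^sup>2 * (norm x)\<^sup>2)\<close>\<close>
  have "ennreal (exp (- (a * (norm x)\<^sup>2)) / norm x) =
      ennreal (2 / sqrt pi) * (\<integral>\<^sup>+v\<in>{0..}. ennreal (exp (- ((a + v\<^sup>2) * (norm x)\<^sup>2))) \<partial>lborel)"
    if "x \<noteq> 0" for x :: "real^3"
  proof -
    have "(\<integral>\<^sup>+v\<in>{0..}. ennreal (exp (- ((a + v\<^sup>2) * (norm x)\<^sup>2))) \<partial>lborel) =
      (\<integral>\<^sup>+v. ennreal (exp (- (a * (norm x)\<^sup>2))) * (ennreal (exp (- ((norm x)\<^sup>2 * v\<^sup>2))) * indicator {0..} v) \<partial>lborel)"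
      by (intro nn_integral_cong)
         (auto simp: indicator_def ennreal_mult[symmetric] mult_exp_exp algebra_simps)
    also have "\<dots> = ennreal (exp (- (a * (norm x)\<^sup>2))) * ennreal (sqrt (pi / (norm x)\<^sup>2) / 2)"
      using that by (subst nn_integral_cmult) (auto simp: nn_integral_gaussian_atLeast_0)
    finally show ?thesis
      by (simp add: ennreal_mult[symmetric] real_sqrt_divide field_simps)
  qed
  \<comment> \<open>At \<open>x = 0\<close> division by zero makes the left integrand 0 while the
    right one is infinite, so the identity is used almost everywhere only.\<close>
  then have "(\<integral>\<^sup>+(x::real^3). ennreal (exp (- (a * (norm x)\<^sup>2)) / norm x) \<partial>lborel) =
     (\<integral>\<^sup>+(x::real^3). ennreal (2 / sqrt pi) * (\<integral>\<^sup>+v\<in>{0..}. ennreal (exp (- ((a + v\<^sup>2) * (norm x)\<^sup>2))) \<partial>lborel) \<partial>lborel)"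
    by (intro nn_integral_cong_AE eventually_mono[OF AE_lborel_singleton[of 0]]) simp
  also have "\<dots> = ennreal (2 / sqrt pi) *
     (\<integral>\<^sup>+(x::real^3). (\<integral>\<^sup>+v\<in>{0..}. ennreal (exp (- ((a + v\<^sup>2) * (norm x)\<^sup>2))) \<partial>lborel) \<partial>lborel)"
    by (rule nn_integral_cmult) measurable
  \<comment> \<open>After the exchange the inner integral is the mass of a Gaussian with parameter
    \<open>a + v\<^sup>2\<close>, which is \<open>pi * sqrt pi\<close> times the integrand of
    \<open>nn_integral_powr_minus_three_halves\<close>.\<close>
  also have "(\<integral>\<^sup>+(x::real^3). (\<integral>\<^sup>+v\<in>{0..}. ennreal (exp (- ((a + v\<^sup>2) * (norm x)\<^sup>2))) \<partial>lborel) \<partial>lborel) =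
     (\<integral>\<^sup>+v. (\<integral>\<^sup>+(x::real^3). ennreal (exp (- ((a + v\<^sup>2) * (norm x)\<^sup>2))) * indicator {0..} v \<partial>lborel) \<partial>lborel)"
    by (rule lborel_pair.Fubini'[symmetric]) measurable
  also have "\<dots> = (\<integral>\<^sup>+v. ennreal (pi * sqrt pi) * (ennreal (1 / sqrt (a + v\<^sup>2) ^ 3) * indicator {0..} v) \<partial>lborel)"
  proof (rule nn_integral_cong)
    fix v :: real
    have "a + v\<^sup>2 > 0" using assms by (simp add: add_pos_nonneg)
    then show "(\<integral>\<^sup>+(x::real^3). ennreal (exp (- ((a + v\<^sup>2) * (norm x)\<^sup>2))) * indicator {0..} v \<partial>lborel) =
        ennreal (pi * sqrt pi) * (ennreal (1 / sqrt (a + v\<^sup>2) ^ 3) * indicator {0..} v)"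
      by (subst nn_integral_multc)
         (auto simp: nn_integral_gaussian_euclidean mult.assoc[symmetric] ennreal_mult[symmetric]
            real_sqrt_divide power_divide power3_eq_cube)
  qed
  also have "\<dots> = ennreal (pi * sqrt pi) * ennreal (1 / a)"
    using assms by (subst nn_integral_cmult) (auto simp: nn_integral_powr_minus_three_halves)
  finally show ?thesis
    using assms by (simp add: ennreal_mult[symmetric] field_simps)
qed

text \<open>Replacing the larger of \<open>norm z\<close> and \<open>norm (z + y)\<close> by the
  smaller one increases the integrand. It is therefore at most the sum of two copies of the
  unshifted integrand, centred at 0 and at \<open>- y\<close>, which makes the bound uniform in
  \<open>y\<close>.\<close>

lemma nn_integral_shifted_gaussian_over_norm:
  fixes y :: "real^3"
  assumes "0 < a"
  shows "(\<integral>\<^sup>+z. ennreal (exp (- (a * (norm (z + y))\<^sup>2)) / norm z) \<partial>lborel) \<le> ennreal (4 * pi / a)"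
proof -
  let ?g = "\<lambda>z :: real^3. ennreal (exp (- (a * (norm z)\<^sup>2)) / norm z)"
  have "ennreal (exp (- (a * (norm (z + y))\<^sup>2)) / norm z) \<le> ?g z + ?g (z + y)" if "z + y \<noteq> 0" for z
  proof (cases "norm z \<le> norm (z + y)")
    case True
    then have "exp (- (a * (norm (z + y))\<^sup>2)) / norm z \<le> exp (- (a * (norm z)\<^sup>2)) / norm z"
      using assms by (intro divide_right_mono) (auto intro!: mult_left_mono power_mono)
    then show ?thesis
      by (intro order_trans[OF _ add_increasing2[of "?g (z + y)" "?g z" "?g z"]] ennreal_leI) auto
  next
    case False
    with that have "exp (- (a * (norm (z + y))\<^sup>2)) / norm z \<le> exp (- (a * (norm (z + y))\<^sup>2)) / norm (z + y)"
      by (intro divide_left_mono) (auto intro!: mult_pos_pos)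
    then show ?thesis
      by (intro order_trans[OF _ add_increasing[of "?g z" "?g (z + y)" "?g (z + y)"]] ennreal_leI) auto
  qed
  then have "(\<integral>\<^sup>+z. ennreal (exp (- (a * (norm (z + y))\<^sup>2)) / norm z) \<partial>lborel) \<le> (\<integral>\<^sup>+z. ?g z + ?g (z + y) \<partial>lborel)"
    by (intro nn_integral_mono_AE eventually_mono[OF AE_lborel_singleton[of "- y"]])
       (metis add.inverse_inverse add_eq_0_iff2)
  also have "\<dots> = ennreal (2 * pi / a) + ennreal (2 * pi / a)"
    using assms by (subst nn_integral_add)
      (auto simp: nn_integral_gaussian_over_norm nn_integral_lborel_shift[where f="?g"])
  finally show ?thesis
    using assms by (simp flip: ennreal_plus)
qed

section \<open>Surface measure on the sphere and Gaussians integrated over it\<close>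

lemma space_sphere_measure [simp]: "space sphere_measure = sphere 0 1"
  by (simp add: sphere_measure_def space_scale_measure space_restrict_space)

lemma sets_sphere_measure [measurable_cong]: "sets sphere_measure = sets (restrict_space borel (sphere 0 1))"
  by (simp add: sphere_measure_def)

lemma measurable_ident_sphere_measure [measurable]: "(\<lambda>\<xi>. \<xi>) \<in> borel_measurable sphere_measure"
  by (subst measurable_cong_sets[OF sets_sphere_measure refl]) (rule measurable_restrict_space1, simp)

lemma finite_measure_sphere_measure: "finite_measure sphere_measure"
  by (rule finite_measureI) (simp add: emeasure_sphere_measure)

lemma nn_integral_sphere_measure:
  assumes [measurable]: "F \<in> borel_measurable borel"
  shows "(\<integral>\<^sup>+\<xi>. F \<xi> \<partial>sphere_measure) = 3 * (\<integral>\<^sup>+x\<in>ball 0 1 - {0}. F (sgn x) \<partial>lborel)"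
proof -
  have m: "sgn \<in> restrict_space lborel (ball 0 1 - {0 :: real^3}) \<rightarrow>\<^sub>M restrict_space borel (sphere 0 1)"
    by (rule measurable_restrict_space3) (auto simp: norm_sgn sgn_div_norm[abs_def])
  have F: "F \<in> borel_measurable (restrict_space borel (sphere 0 1))"
    by (rule measurable_restrict_space1) simp
  show ?thesis
    unfolding sphere_measure_def using F
    by (simp add: nn_integral_scale_measure nn_integral_distr[OF m] nn_integral_restrict_space)
qed

text \<open>
  Place Gaussians \<open>exp (- c * (norm (x + \<rho> *\<^sub>R \<eta>))\<^sup>2)\<close> at the points \<open>- \<rho> *\<^sub>R \<eta>\<close>.  Their exponent is
  \<open>(norm x - \<rho>)\<^sup>2 + norm x * \<rho> * (norm (sgn x + \<eta>))\<^sup>2\<close>, so integrating \<open>\<rho>\<close> over \<open>{0..2}\<close> dominates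
  \<open>exp (- 2 * c * (norm (sgn x + \<eta>))\<^sup>2)\<close> up to the factor \<open>sqrt c\<close>, while each of them has
  total integral \<open>(pi / c) powr (3 / 2)\<close>.
\<close>

lemma nn_integral_sphere_gaussian_large:
  assumes \<eta>: "norm \<eta> = 1" and c: "1 \<le> c"
  shows "(\<integral>\<^sup>+\<xi>. ennreal (exp (- (2 * c * (norm (\<xi> + \<eta>))\<^sup>2))) \<partial>sphere_measure) \<le> ennreal (6 * exp 1 * pi * sqrt pi / c)"
proof -
  let ?E = "\<lambda>x. exp (- (2 * c * (norm (sgn x + \<eta>))\<^sup>2))"
  let ?I = "\<lambda>x. \<integral>\<^sup>+\<rho>\<in>{0..2}. ennreal (exp (- (c * (norm (x + \<rho> *\<^sub>R \<eta>))\<^sup>2))) \<partial>lborel"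
  have s: "sqrt c > 0" "1 / sqrt c \<le> 1" using c by auto
  have le: "ennreal (?E x) \<le> ennreal (exp 1 * sqrt c) * ?I x" if x: "x \<in> ball 0 1 - {0}" for x :: "real^3"
  proof -
    define r where "r = norm x"
    have r: "0 < r" "r < 1" using x by (auto simp: r_def)
    have u: "sgn x \<bullet> sgn x = 1" "\<eta> \<bullet> \<eta> = 1"
      using x \<eta> by (auto simp: norm_sgn dot_square_norm)
    have xr: "x = r *\<^sub>R sgn x" using x by (simp add: r_def sgn_div_norm)
    have id: "(norm (x + \<rho> *\<^sub>R \<eta>))\<^sup>2 = (r - \<rho>)\<^sup>2 + r * \<rho> * (norm (sgn x + \<eta>))\<^sup>2" for \<rho>
    proof -
      have "(norm (r *\<^sub>R sgn x + \<rho> *\<^sub>R \<eta>))\<^sup>2 = r\<^sup>2 + \<rho>\<^sup>2 + 2 * r * \<rho> * (sgn x \<bullet> \<eta>)"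
        using u unfolding power2_norm_eq_inner
        by (simp add: inner_add_left inner_add_right inner_commute power2_eq_square algebra_simps)
      moreover have "(norm (sgn x + \<eta>))\<^sup>2 = 2 + 2 * (sgn x \<bullet> \<eta>)"
        using u by (simp add: power2_norm_eq_inner inner_add_left inner_add_right inner_commute)
      ultimately show ?thesis using xr by (simp add: power2_eq_square algebra_simps)
    qed
    \<comment> \<open>On the window of length \<open>1 / sqrt c\<close> starting at \<open>r\<close>
      the radial part of the exponent is at most 1, which costs \<open>exp (-1)\<close>. Since
      \<open>r < 1\<close> and \<open>1 / sqrt c \<le> 1\<close>, the window lies in
      \<open>{0..2}\<close> and \<open>r * \<rho> \<le> 2\<close>, whence the 2 in the exponent of
      \<open>?E\<close>.\<close>
    have "ennreal (exp (-1) * ?E x / sqrt c) =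
        (\<integral>\<^sup>+\<rho>. ennreal (exp (-1) * ?E x) * indicator {r..r + 1 / sqrt c} \<rho> \<partial>lborel)"
      using s by (subst nn_integral_cmult_indicator) (auto simp: ennreal_mult[symmetric])
    also have "\<dots> \<le> ?I x"
    proof (rule nn_integral_mono)
      fix \<rho> :: real
      show "ennreal (exp (-1) * ?E x) * indicator {r..r + 1 / sqrt c} \<rho>
        \<le> ennreal (exp (- (c * (norm (x + \<rho> *\<^sub>R \<eta>))\<^sup>2))) * indicator {0..2} \<rho>"
      proof (cases "\<rho> \<in> {r..r + 1 / sqrt c}")
        case True
        then have "r \<le> \<rho>" "\<rho> \<le> r + 1 / sqrt c" by auto
        with r s(2) have \<rho>: "0 \<le> \<rho>" "\<rho> \<le> 2" "\<bar>r - \<rho>\<bar> \<le> 1 / sqrt c" by linarith+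
        have "(r - \<rho>)\<^sup>2 \<le> (1 / sqrt c)\<^sup>2" using \<rho>(3) s by (metis abs_le_square_iff abs_of_pos zero_less_divide_1_iff)
        then have "c * (r - \<rho>)\<^sup>2 \<le> 1" using c by (simp add: power_divide field_simps)
        moreover have "c * (r * \<rho> * (norm (sgn x + \<eta>))\<^sup>2) \<le> c * (2 * (norm (sgn x + \<eta>))\<^sup>2)"
          using \<rho> r c mult_mono[of r 1 \<rho> 2] by (intro mult_left_mono mult_right_mono) auto
        ultimately have "exp (-1) * ?E x \<le> exp (- (c * (norm (x + \<rho> *\<^sub>R \<eta>))\<^sup>2))"
          unfolding id exp_add[symmetric] by (simp add: algebra_simps)
        with True \<rho> show ?thesis by (simp add: ennreal_leI)
      qed simp
    qed
    finally have "ennreal (exp 1 * sqrt c) * ennreal (exp (-1) * ?E x / sqrt c) \<le> ennreal (exp 1 * sqrt c) * ?I x"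
      by (rule mult_left_mono) simp
    moreover have "exp 1 * sqrt c * (exp (-1) * ?E x / sqrt c) = ?E x"
      using s by (simp add: exp_minus)
    moreover have "ennreal (exp 1 * sqrt c) * ennreal (exp (-1) * ?E x / sqrt c)
        = ennreal (exp 1 * sqrt c * (exp (-1) * ?E x / sqrt c))"
      using c by (intro ennreal_mult[symmetric]) auto
    ultimately show ?thesis by metis
  qed
  have "(\<integral>\<^sup>+x\<in>ball 0 1 - {0}. ennreal (?E x) \<partial>lborel) \<le> (\<integral>\<^sup>+x. ennreal (exp 1 * sqrt c) * ?I x \<partial>lborel)"
    using le by (intro nn_integral_mono) (auto simp: indicator_def)
  also have "\<dots> = ennreal (exp 1 * sqrt c) * (\<integral>\<^sup>+x. ?I x \<partial>lborel)"
    by (rule nn_integral_cmult) measurable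
  also have "(\<integral>\<^sup>+x. ?I x \<partial>lborel) = (\<integral>\<^sup>+\<rho>. (\<integral>\<^sup>+x. ennreal (exp (- (c * (norm (x + \<rho> *\<^sub>R \<eta>))\<^sup>2))) * indicator {0..2} \<rho> \<partial>lborel) \<partial>lborel)"
    by (rule lborel_pair.Fubini'[symmetric]) measurable
  also have "\<dots> = (\<integral>\<^sup>+\<rho>. ennreal (sqrt (pi / c) ^ 3) * indicator {0..2::real} \<rho> \<partial>lborel)"
    using c by (intro nn_integral_cong, subst nn_integral_multc)
      (auto simp: nn_integral_gaussian_euclidean nn_integral_lborel_shift[where f="\<lambda>z. ennreal (exp (- (c * (norm z)\<^sup>2)))"])
  also have "\<dots> = ennreal (2 * sqrt (pi / c) ^ 3)"
    using c by (subst nn_integral_cmult_indicator) (auto simp: ennreal_mult mult.commute)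
  finally have "(\<integral>\<^sup>+x\<in>ball 0 1 - {0}. ennreal (?E x) \<partial>lborel) \<le> ennreal (exp 1 * sqrt c * (2 * sqrt (pi / c) ^ 3))"
    using c by (simp add: ennreal_mult)
  then have "3 * (\<integral>\<^sup>+x\<in>ball 0 1 - {0}. ennreal (?E x) \<partial>lborel) \<le> ennreal 3 * ennreal (exp 1 * sqrt c * (2 * sqrt (pi / c) ^ 3))"
    by (intro mult_mono) auto
  also have "\<dots> = ennreal (3 * (exp 1 * sqrt c * (2 * sqrt (pi / c) ^ 3)))"
    using c by (subst ennreal_mult) auto
  \<comment> \<open>The 3 comes from the cone measure and the inner 2 from the length of the
    \<rho>-interval; \<open>sqrt c\<close> against \<open>sqrt c ^ 3\<close> leaves the decay
    \<open>1 / c\<close> of a Gaussian on a surface.\<close>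
  also have "3 * (exp 1 * sqrt c * (2 * sqrt (pi / c) ^ 3)) = 6 * exp 1 * pi * sqrt pi / c"
  proof -
    have "3 * (e * t * (2 * (p / t) ^ 3)) = 6 * e * (p * p) * p / (t * t)" if "t > 0" for e t p :: real
      using that by (simp add: field_simps power3_eq_cube)
    from this[of "sqrt c" "exp 1" "sqrt pi"] show ?thesis
      using c by (simp add: real_sqrt_divide)
  qed
  finally show ?thesis
    by (subst nn_integral_sphere_measure) auto
qed

text \<open>Decay \<open>1 / c\<close> for large \<open>c\<close> is combined with the total mass
  \<open>4 * pi\<close> for small \<open>c\<close>, and \<theta> interpolates between the two. The
  constant is twice the earlier one because the large case is applied to
  \<open>c / 2\<close>.\<close>

lemma nn_integral_sphere_gaussian:
  assumes \<eta>: "norm \<eta> = 1" and c: "0 < c" and \<theta>: "0 \<le> \<theta>" "\<theta> \<le> 1"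
  shows "(\<integral>\<^sup>+\<xi>. ennreal (exp (- (c * (norm (\<xi> + \<eta>))\<^sup>2))) \<partial>sphere_measure)
    \<le> ennreal (12 * exp 1 * pi * sqrt pi * c powr (- \<theta>))"
proof (cases "c \<ge> 2")
  case True
  have "1 / c = c powr (- 1)" using c by (simp add: powr_minus_divide)
  also have "\<dots> \<le> c powr (- \<theta>)" using True \<theta> by (intro powr_mono) auto
  finally have "12 * exp 1 * pi * sqrt pi * (1 / c) \<le> 12 * exp 1 * pi * sqrt pi * c powr (- \<theta>)"
    by (intro mult_left_mono) auto
  then show ?thesis
    using nn_integral_sphere_gaussian_large[OF \<eta>, of "c / 2"] True
    by (simp add: order_trans[OF _ ennreal_leI] mult.assoc)
next
  case False
  \<comment> \<open>Below the threshold 2 the power is at least \<open>1 / 2\<close>, so the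
    constant only has to exceed twice the total mass.\<close>
  have "1 / 2 = 2 powr (-1 :: real)" by (simp add: powr_minus_divide)
  also have "\<dots> \<le> 2 powr (- \<theta>)" using \<theta> by (intro powr_mono) auto
  also have "\<dots> \<le> c powr (- \<theta>)" using False c \<theta> by (intro powr_mono2') auto
  finally have p: "1 / 2 \<le> c powr (- \<theta>)" .
  have "1 * 1 \<le> exp 1 * sqrt pi" using pi_gt3 by (intro mult_mono) auto
  then have "8 * pi * 1 \<le> (12 * pi) * (exp 1 * sqrt pi)" by (intro mult_mono) auto
  from mult_mono[OF this p] have "4 * pi \<le> 12 * exp 1 * pi * sqrt pi * c powr (- \<theta>)"
    by (simp add: algebra_simps)
  moreover have "(\<integral>\<^sup>+\<xi>. ennreal (exp (- (c * (norm (\<xi> + \<eta>))\<^sup>2))) \<partial>sphere_measure) \<le> (\<integral>\<^sup>+\<xi>. 1 \<partial>sphere_measure)"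
    using c by (intro nn_integral_mono) auto
  ultimately show ?thesis
    by (simp add: emeasure_sphere_measure order_trans[OF _ ennreal_leI])
qed

section \<open>Finite differences of Gaussians\<close>

text \<open>This is \<open>min 1 t \<le> t powr \<theta>\<close>, packaged so that the linear bound
  is asked for only when \<open>t \<le> 1\<close>, the range in which the difference estimates are
  proved.\<close>

lemma le_mult_powr_interpolate:
  fixes t :: real
  assumes "0 \<le> t" "0 < \<theta>" "\<theta> \<le> 1" "0 \<le> K" "X \<le> K" "t \<le> 1 \<Longrightarrow> X \<le> K * t"
  shows "X \<le> K * t powr \<theta>"
proof (cases "t \<le> 1")
  case True
  have "t powr 1 \<le> t powr \<theta>"
  proof (cases "t = 0")
    case False
    with True assms show ?thesis by (intro powr_mono') auto
  qed simp
  with assms have "K * t \<le> K * t powr \<theta>" by (intro mult_left_mono) auto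
  with True assms show ?thesis by linarith
next
  case False
  with assms have "1 \<le> t powr \<theta>" by (intro ge_one_powr_ge_zero) auto
  with assms have "K * 1 \<le> K * t powr \<theta>" by (intro mult_left_mono) auto
  with assms show ?thesis by linarith
qed

text \<open>The larger exponential is factored out and \<open>1 - exp (- u) \<le> u\<close> is
  applied to the rest.\<close>

lemma abs_exp_minus_diff_le:
  fixes p q :: real
  shows "\<bar>exp (- p) - exp (- q)\<bar> \<le> \<bar>p - q\<bar> * exp (- min p q)"
proof -
  have *: "exp (- p) - exp (- q) \<le> (q - p) * exp (- p)" if "p \<le> q" for p q :: real
  proof -
    have "exp (- p) - exp (- q) = exp (- p) * (1 - exp (- (q - p)))"
      by (simp add: algebra_simps exp_add[symmetric])
    also have "1 - exp (- (q - p)) \<le> q - p"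
      using exp_ge_add_one_self[of "- (q - p)"] by linarith
    finally show ?thesis by (simp add: mult.commute)
  qed
  show ?thesis
  proof (cases "p \<le> q")
    case True
    then have "exp (- q) \<le> exp (- p)" by simp
    with *[OF True] True show ?thesis by (simp add: min_def)
  next
    case False
    then have "exp (- p) \<le> exp (- q)" by simp
    with *[of q p] False show ?thesis by (simp add: min_def)
  qed
qed

text \<open>The lower side is the tangent line; the upper side follows from
  \<open>exp (- u) \<le> 1 / (1 + u)\<close> and
  \<open>(1 + u) * (1 - u + u\<^sup>2) = 1 + u ^ 3\<close>.\<close>

lemma abs_exp_minus_remainder_le:
  fixes u :: real
  assumes "0 \<le> u"
  shows "\<bar>exp (- u) - (1 - u)\<bar> \<le> u\<^sup>2"
proof -
  have "exp (- u) \<le> 1 / (1 + u)"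
    using exp_ge_add_one_self[of u] assms by (simp add: exp_minus field_simps)
  also have "\<dots> \<le> 1 - u + u\<^sup>2"
    using assms by (simp add: field_simps power2_eq_square)
  finally show ?thesis
    using exp_ge_add_one_self[of "- u"] by simp
qed

text \<open>Here \<open>x\<close> and \<open>x'\<close> stand for \<open>sqrt a\<close> times the
  two norms. Of the exponent \<open>x\<^sup>2\<close>, half is lost in passing to the smaller of the
  two squares and a quarter in absorbing the linear factor \<open>2 * x + 1\<close>; a quarter
  remains.\<close>

lemma gaussian_first_difference_real:
  fixes x x' t :: real
  assumes "0 \<le> x" "0 \<le> x'" "\<bar>x' - x\<bar> \<le> t" "t \<le> 1"
  shows "\<bar>exp (- x'\<^sup>2) - exp (- x\<^sup>2)\<bar> \<le> 5 * exp 1 * t * exp (- (x\<^sup>2 / 4))"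
proof -
  have "0 \<le> t" using assms by linarith
  have "\<bar>x'\<^sup>2 - x\<^sup>2\<bar> = \<bar>x' - x\<bar> * (x' + x)"
  proof -
    have "x'\<^sup>2 - x\<^sup>2 = (x' - x) * (x' + x)" by (simp add: power2_eq_square algebra_simps)
    with assms show ?thesis by (simp add: abs_mult)
  qed
  also have "\<dots> \<le> t * (2 * x + 1)"
    using assms by (intro mult_mono) auto
  finally have 1: "\<bar>x'\<^sup>2 - x\<^sup>2\<bar> \<le> t * (2 * x + 1)" .
  \<comment> \<open>Together these give \<open>x\<^sup>2 \<le> 2 * x'\<^sup>2 + 2\<close>.\<close>
  have "x\<^sup>2 \<le> (x' + 1)\<^sup>2" using assms by (intro power_mono) auto
  moreover have "0 \<le> (x' - 1)\<^sup>2" by simp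
  ultimately have "x\<^sup>2 / 2 - 1 \<le> x'\<^sup>2" by (simp add: power2_eq_square algebra_simps)
  then have "- min (x'\<^sup>2) (x\<^sup>2) \<le> 1 - x\<^sup>2 / 2"
    using zero_le_power2[of x] by linarith
  then have 2: "exp (- min (x'\<^sup>2) (x\<^sup>2)) \<le> exp (1 - x\<^sup>2 / 2)" by simp
  have "0 \<le> (x / 2 - 2)\<^sup>2" by simp
  then have "2 * x \<le> 4 + x\<^sup>2 / 4" by (simp add: power2_eq_square algebra_simps)
  moreover have "2 * x + 1 \<le> 5 * (1 + X / 4)" if "2 * x \<le> 4 + X / 4" "0 \<le> X" for X
    using that by (simp add: field_simps)
  ultimately have "2 * x + 1 \<le> 5 * (1 + x\<^sup>2 / 4)" using zero_le_power2 by blast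
  also have "\<dots> \<le> 5 * exp (x\<^sup>2 / 4)" by (intro mult_left_mono exp_ge_add_one_self) auto
  finally have 3: "2 * x + 1 \<le> 5 * exp (x\<^sup>2 / 4)" .
  have "\<bar>exp (- x'\<^sup>2) - exp (- x\<^sup>2)\<bar> \<le> \<bar>x'\<^sup>2 - x\<^sup>2\<bar> * exp (- min (x'\<^sup>2) (x\<^sup>2))"
    by (rule abs_exp_minus_diff_le)
  also have "\<dots> \<le> (t * (5 * exp (x\<^sup>2 / 4))) * exp (1 - x\<^sup>2 / 2)"
    using 2 \<open>0 \<le> t\<close> assms
    by (intro mult_mono order_trans[OF 1] mult_left_mono 3) auto
  also have "\<dots> = 5 * t * exp (x\<^sup>2 / 4 + (1 - x\<^sup>2 / 2))"
    unfolding exp_add by simp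
  also have "x\<^sup>2 / 4 + (1 - x\<^sup>2 / 2) = 1 + - (x\<^sup>2 / 4)" by simp
  finally show ?thesis unfolding exp_add by (simp only: mult_ac)
qed

text \<open>Here \<open>x\<^sup>2\<close>, \<open>b\<close> and \<open>c\<close> stand for
  \<open>a * (norm z)\<^sup>2\<close>, \<open>a * (norm y)\<^sup>2\<close> and
  \<open>2 * a * (z \<bullet> y)\<close>, and the hypothesis on \<open>c\<close> is Cauchy-Schwarz.
  Adding the terms for \<open>c\<close> and \<open>- c\<close> cancels the part odd in
  \<open>c\<close>; what is left is of order \<open>b + c\<^sup>2\<close>, hence of order
  \<open>b\<close> up to factors that the exponential absorbs.\<close>

lemma gaussian_second_difference_real:
  fixes b c x :: real
  assumes "0 \<le> b" "b \<le> 1" "0 \<le> x" "c\<^sup>2 \<le> 4 * b * x\<^sup>2"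
  shows "\<bar>exp (- (x\<^sup>2 + b + c)) + exp (- (x\<^sup>2 + b - c)) - 2 * exp (- x\<^sup>2)\<bar>
    \<le> 16 * exp 4 * b * exp (- (x\<^sup>2 / 4))"
proof -
  have "b * x\<^sup>2 \<le> 1 * x\<^sup>2" using assms by (intro mult_right_mono) auto
  with assms have "c\<^sup>2 \<le> (2 * x)\<^sup>2" by (simp add: power_mult_distrib)
  then have "\<bar>c\<bar> \<le> 2 * x" using assms(3) abs_le_square_iff[of c "2 * x"] by simp
  also have "2 * x \<le> 4 + x\<^sup>2 / 4"
    using zero_le_power2[of "x / 2 - 2"] by (simp add: power2_eq_square algebra_simps)
  finally have c: "exp \<bar>c\<bar> \<le> exp (4 + x\<^sup>2 / 4)" by simp
  \<comment> \<open>The excess of \<open>exp c + exp (- c)\<close> over 2 is the square of a first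
    difference, hence nonnegative and quadratic in \<open>c\<close>.\<close>
  have sq: "(exp (c / 2) - exp (- (c / 2)))\<^sup>2 = exp c + exp (- c) - 2"
    by (simp add: power2_diff mult_exp_exp mult.assoc flip: exp_double)
  have "\<bar>exp (c / 2) - exp (- (c / 2))\<bar> \<le> \<bar>c\<bar> * exp (\<bar>c\<bar> / 2)"
    using abs_exp_minus_diff_le[of "- (c / 2)" "c / 2"] by (simp add: min_def abs_if split: if_splits)
  then have "(exp (c / 2) - exp (- (c / 2)))\<^sup>2 \<le> (\<bar>c\<bar> * exp (\<bar>c\<bar> / 2))\<^sup>2"
    by (metis abs_ge_zero power2_abs power_mono)
  moreover note sq
  moreover have "(\<bar>c\<bar> * exp (\<bar>c\<bar> / 2))\<^sup>2 = c\<^sup>2 * exp \<bar>c\<bar>"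
    by (simp add: power_mult_distrib flip: exp_double)
  ultimately have cosh: "exp c + exp (- c) - 2 \<le> c\<^sup>2 * exp \<bar>c\<bar>" by simp
  have "0 \<le> (exp (c / 2) - exp (- (c / 2)))\<^sup>2" by simp
  then have cosh0: "0 \<le> exp c + exp (- c) - 2"
    unfolding sq .
  have "exp c \<le> exp \<bar>c\<bar>" "exp (- c) \<le> exp \<bar>c\<bar>" by simp_all
  then have cc: "exp c + exp (- c) \<le> 2 * exp \<bar>c\<bar>" by linarith
  have b: "\<bar>exp (- b) - 1\<bar> \<le> b"
    using abs_exp_minus_diff_le[of b 0] assms by (simp add: min_def split: if_splits)
  \<comment> \<open>Separates the change caused by \<open>b\<close> from the even change caused by
    \<open>c\<close>.\<close>
  have "exp (- (x\<^sup>2 + b + c)) + exp (- (x\<^sup>2 + b - c)) - 2 * exp (- x\<^sup>2) =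
      exp (- x\<^sup>2) * ((exp (- b) - 1) * (exp c + exp (- c)) + (exp c + exp (- c) - 2))"
    by (simp add: algebra_simps mult_exp_exp)
  also have "\<bar>\<dots>\<bar> \<le> exp (- x\<^sup>2) * (\<bar>exp (- b) - 1\<bar> * (exp c + exp (- c)) + (exp c + exp (- c) - 2))"
    using cosh0 by (simp add: abs_mult) (rule order_trans[OF abs_triangle_ineq], simp add: abs_mult)
  also have "\<dots> \<le> exp (- x\<^sup>2) * (b * (2 * exp \<bar>c\<bar>) + (4 * b * x\<^sup>2) * exp \<bar>c\<bar>)"
    using b cc assms
    by (intro mult_left_mono add_mono mult_mono order_trans[OF cosh] mult_right_mono) auto
  also have "\<dots> = exp (- x\<^sup>2) * b * (2 + 4 * x\<^sup>2) * exp \<bar>c\<bar>" by (simp add: algebra_simps)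
  \<comment> \<open>One quarter of the exponent pays for the polynomial and another for
    \<open>exp \<bar>c\<bar>\<close>.\<close>
  also have "\<dots> \<le> exp (- x\<^sup>2) * b * (16 * exp (x\<^sup>2 / 4)) * exp (4 + x\<^sup>2 / 4)"
  proof (intro mult_mono mult_left_mono c)
    have "2 + 4 * x\<^sup>2 \<le> 16 * (1 + x\<^sup>2 / 4)" by simp
    also have "\<dots> \<le> 16 * exp (x\<^sup>2 / 4)" by (intro mult_left_mono exp_ge_add_one_self) auto
    finally show "2 + 4 * x\<^sup>2 \<le> 16 * exp (x\<^sup>2 / 4)" .
  qed (use assms in auto)
  also have "\<dots> = 16 * b * exp (- x\<^sup>2 + x\<^sup>2 / 4 + (4 + x\<^sup>2 / 4))"
    unfolding exp_add by simp
  also have "\<dots> \<le> 16 * b * exp (4 + - (x\<^sup>2 / 4))"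
    using assms by (intro mult_left_mono) auto
  finally show ?thesis unfolding exp_add by (simp only: mult_ac)
qed

text \<open>Scaling by \<open>sqrt a\<close> reduces short steps to the real estimate. For long
  steps the difference is bounded by the sum of the two Gaussians, which is why both appear on the
  right.\<close>

lemma gaussian_first_difference:
  fixes y z :: "'a::real_inner"
  assumes "0 < a" "0 < \<gamma>" "\<gamma> \<le> 1"
  shows "\<bar>exp (- (a * (norm (z + y))\<^sup>2)) - exp (- (a * (norm z)\<^sup>2))\<bar>
    \<le> 5 * exp 1 * (sqrt a * norm y) powr \<gamma>
       * (exp (- (a / 4 * (norm (z + y))\<^sup>2)) + exp (- (a / 4 * (norm z)\<^sup>2)))" (is "?l \<le> _ * ?p * (?u + ?v)")
proof -
  have u: "exp (- (a * (norm x)\<^sup>2)) \<le> exp (- (a / 4 * (norm x)\<^sup>2))" for x :: 'a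
    using assms by simp
  have e: "1 \<le> 5 * exp (1::real)" using exp_ge_add_one_self[of "1::real"] by linarith
  have "?l \<le> (5 * exp 1 * (?u + ?v)) * (sqrt a * norm y) powr \<gamma>"
  proof (rule le_mult_powr_interpolate)
    have "?l \<le> exp (- (a * (norm (z + y))\<^sup>2)) + exp (- (a * (norm z)\<^sup>2))"
      by (simp add: abs_if)
    also have "\<dots> \<le> 1 * (?u + ?v)" unfolding mult_1 by (intro add_mono u)
    also have "\<dots> \<le> 5 * exp 1 * (?u + ?v)" using e by (intro mult_right_mono) auto
    finally show "?l \<le> 5 * exp 1 * (?u + ?v)" .
  next
    assume t: "sqrt a * norm y \<le> 1"
    have "\<bar>norm (z + y) - norm z\<bar> \<le> norm y"
      using norm_triangle_ineq3[of "z + y" z] by simp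
    then have "sqrt a * \<bar>norm (z + y) - norm z\<bar> \<le> sqrt a * norm y"
      using assms by (intro mult_left_mono) auto
    then have "\<bar>sqrt a * norm (z + y) - sqrt a * norm z\<bar> \<le> sqrt a * norm y"
      using assms by (simp add: abs_mult flip: right_diff_distrib)
    from gaussian_first_difference_real[OF _ _ this t] assms
    have "?l \<le> 5 * exp 1 * (sqrt a * norm y) * ?v"
      by (simp add: power_mult_distrib)
    also have "\<dots> \<le> 5 * exp 1 * (sqrt a * norm y) * (?u + ?v)"
      using assms by (intro mult_left_mono) auto
    finally show "?l \<le> 5 * exp 1 * (?u + ?v) * (sqrt a * norm y)" by (simp only: mult_ac)
  qed (use assms in auto)
  then show ?thesis by (simp only: mult_ac)
qed

text \<open>The interpolation runs in \<open>a * (norm y)\<^sup>2\<close>, the square of the scaled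
  step, with exponent \<open>\<gamma> / 2\<close>; this admits \<gamma> up to 2.\<close>

lemma gaussian_second_difference:
  fixes y z :: "'a::real_inner"
  assumes "0 < a" "0 < \<gamma>" "\<gamma> \<le> 2"
  shows "\<bar>exp (- (a * (norm (z + y))\<^sup>2)) + exp (- (a * (norm (z - y))\<^sup>2)) - 2 * exp (- (a * (norm z)\<^sup>2))\<bar>
    \<le> 16 * exp 4 * (sqrt a * norm y) powr \<gamma>
       * (exp (- (a / 4 * (norm (z + y))\<^sup>2)) + exp (- (a / 4 * (norm (z - y))\<^sup>2)) + exp (- (a / 4 * (norm z)\<^sup>2)))"
  (is "?l \<le> _ * ?p * (?u + ?u' + ?v)")
proof -
  have u: "exp (- (a * (norm x)\<^sup>2)) \<le> exp (- (a / 4 * (norm x)\<^sup>2))" for x :: 'a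
    using assms by simp
  have e: "2 \<le> 16 * exp (4::real)" using exp_ge_add_one_self[of "4::real"] by linarith
  have "?l \<le> (16 * exp 4 * (?u + ?u' + ?v)) * (a * (norm y)\<^sup>2) powr (\<gamma> / 2)"
  proof (rule le_mult_powr_interpolate)
    have "?l \<le> exp (- (a * (norm (z + y))\<^sup>2)) + exp (- (a * (norm (z - y))\<^sup>2)) + 2 * exp (- (a * (norm z)\<^sup>2))"
      by (simp add: abs_if)
    also have "\<dots> \<le> ?u + ?u' + 2 * ?v"
      by (intro add_mono mult_left_mono u) auto
    also have "\<dots> \<le> 2 * (?u + ?u' + ?v)"
    proof -
      have "p + q + 2 * r \<le> 2 * (p + q + r)" if "0 \<le> p" "0 \<le> q" for p q r :: real
        using that by simp
      then show ?thesis by simp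
    qed
    also have "\<dots> \<le> 16 * exp 4 * (?u + ?u' + ?v)" using e by (intro mult_right_mono) auto
    finally show "?l \<le> 16 * exp 4 * (?u + ?u' + ?v)" .
  next
    assume t: "a * (norm y)\<^sup>2 \<le> 1"
    have "(2 * a * (z \<bullet> y))\<^sup>2 = 4 * a\<^sup>2 * \<bar>z \<bullet> y\<bar>\<^sup>2" by (simp add: power_mult_distrib)
    also have "\<dots> \<le> 4 * a\<^sup>2 * (norm z * norm y)\<^sup>2"
      by (intro mult_left_mono power_mono Cauchy_Schwarz_ineq2) auto
    also have "\<dots> = 4 * (a * (norm y)\<^sup>2) * (sqrt a * norm z)\<^sup>2"
      using assms by (simp add: power_mult_distrib power2_eq_square[of a])
    finally have c: "(2 * a * (z \<bullet> y))\<^sup>2 \<le> 4 * (a * (norm y)\<^sup>2) * (sqrt a * norm z)\<^sup>2" .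
    have eq: "(sqrt a * norm z)\<^sup>2 + a * (norm y)\<^sup>2 + 2 * a * (z \<bullet> y) = a * (norm (z + y))\<^sup>2"
      "(sqrt a * norm z)\<^sup>2 + a * (norm y)\<^sup>2 - 2 * a * (z \<bullet> y) = a * (norm (z - y))\<^sup>2"
      using assms unfolding power_mult_distrib power2_norm_eq_inner
      by (simp_all add: inner_add_left inner_add_right inner_diff_left inner_diff_right inner_commute algebra_simps)
    from gaussian_second_difference_real[OF _ t _ c] assms
    have "?l \<le> 16 * exp 4 * (a * (norm y)\<^sup>2) * ?v"
      unfolding eq by (simp add: power_mult_distrib)
    also have "\<dots> \<le> 16 * exp 4 * (a * (norm y)\<^sup>2) * (?u + ?u' + ?v)"
      using assms by (intro mult_left_mono) auto
    finally show "?l \<le> 16 * exp 4 * (?u + ?u' + ?v) * (a * (norm y)\<^sup>2)" by (simp only: mult_ac)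
  qed (use assms in auto)
  also have "(a * (norm y)\<^sup>2) powr (\<gamma> / 2) = (sqrt a * norm y) powr \<gamma>"
    using assms by (cases "y = 0") (auto simp: powr_mult powr_half_sqrt[symmetric] powr_powr simp flip: powr_numeral)
  finally show ?thesis by (simp only: mult_ac)
qed

section \<open>Gaussian differences at the points of the sphere integrals\<close>

text \<open>The exponents are those of \<open>norm_cone_points\<close> with
  \<open>q = (norm (\<xi> + \<eta>))\<^sup>2\<close>. They differ by
  \<open>a * h * q * s + a * h\<^sup>2 * (q - 1)\<close>, and both are at least
  \<open>m\<^sup>2 = a * q * s\<^sup>2\<close>. When \<open>sqrt a * h \<le> 1\<close>, the
  difference is at most \<open>sqrt a * h\<close> times a linear function of \<open>m\<close>, which
  half of the exponent absorbs.\<close>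

lemma cone_first_difference:
  fixes a h q s :: real
  assumes "0 < a" "0 < h" "0 \<le> s" "0 \<le> q" "q \<le> 4" "0 < \<rho>" "\<rho> \<le> 1"
  shows "\<bar>exp (- (a * (q * (s + h)\<^sup>2))) - exp (- (a * (q * (s * (s + h)) + h\<^sup>2)))\<bar>
    \<le> 7 * (sqrt a * h) powr \<rho> * exp (- (a * s\<^sup>2 / 2 * q))" (is "?l \<le> _ * _ * ?v")
proof -
  define m where "m = sqrt (a * q) * s"
  have m: "0 \<le> m" "m\<^sup>2 = a * s\<^sup>2 * q" using assms by (auto simp: m_def power_mult_distrib)
  have v: "?v = exp (- (m\<^sup>2 / 2))" by (simp add: m)
  have le1: "m\<^sup>2 \<le> a * (q * (s + h)\<^sup>2)"
  proof -
    have "s\<^sup>2 \<le> (s + h)\<^sup>2" using assms by (intro power_mono) auto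
    then have "a * q * s\<^sup>2 \<le> a * q * (s + h)\<^sup>2" using assms by (intro mult_left_mono) auto
    then show ?thesis by (simp add: m mult_ac)
  qed
  have le2: "m\<^sup>2 \<le> a * (q * (s * (s + h)) + h\<^sup>2)"
  proof -
    have "a * (q * (s * (s + h)) + h\<^sup>2) = m\<^sup>2 + (a * q * s * h + a * h\<^sup>2)"
      unfolding m(2) by (simp add: algebra_simps power2_eq_square)
    moreover have "0 \<le> a * q * s * h + a * h\<^sup>2" using assms by simp
    ultimately show ?thesis by linarith
  qed
  have min: "m\<^sup>2 \<le> min (a * (q * (s + h)\<^sup>2)) (a * (q * (s * (s + h)) + h\<^sup>2))"
    using le1 le2 by simp
  have "?l \<le> (7 * ?v) * (sqrt a * h) powr \<rho>"
  proof (rule le_mult_powr_interpolate)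
    have "?l \<le> exp (- (a * (q * (s + h)\<^sup>2))) + exp (- (a * (q * (s * (s + h)) + h\<^sup>2)))"
      by (simp add: abs_if)
    also have "\<dots> \<le> exp (- m\<^sup>2) + exp (- m\<^sup>2)" using le1 le2 by (intro add_mono) auto
    also have "\<dots> \<le> 7 * exp (- (m\<^sup>2 / 2))" by (smt (verit) exp_le_cancel_iff exp_ge_zero zero_le_power2 field_sum_of_halves)
    finally show "?l \<le> 7 * ?v" unfolding v .
  next
    assume t: "sqrt a * h \<le> 1"
    have "sqrt q \<le> 2" using assms by (simp add: real_le_lsqrt real_sqrt_le_iff[of q 4, simplified])
    have t2: "a * h\<^sup>2 \<le> sqrt a * h"
    proof -
      have "a * h\<^sup>2 = (sqrt a * h) * (sqrt a * h)" using assms by (simp add: power2_eq_square)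
      also have "\<dots> \<le> (sqrt a * h) * 1" using assms t by (intro mult_left_mono) auto
      finally show ?thesis by simp
    qed
    \<comment> \<open>One factor \<open>sqrt a\<close> goes with the step \<open>h\<close>; the rest
      is \<open>sqrt q * m\<close> with \<open>sqrt q \<le> 2\<close>.\<close>
    have "a * (h * (q * s)) = (sqrt a * sqrt a) * (sqrt q * sqrt q) * h * s"
      using assms by simp
    also have "\<dots> = (sqrt a * h) * (sqrt q * m)"
      by (simp only: m_def real_sqrt_mult mult_ac)
    also have "\<dots> \<le> (sqrt a * h) * (2 * m)"
      using \<open>sqrt q \<le> 2\<close> m assms by (intro mult_left_mono mult_right_mono) auto
    finally have "a * (h * (q * s)) \<le> (sqrt a * h) * (2 * m)" .
    moreover have "0 \<le> a * (h * (q * s))" using assms by simp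
    ultimately have 1: "\<bar>a * (h * (q * s))\<bar> \<le> (sqrt a * h) * (2 * m)" by linarith
    have "\<bar>a * (q * (s + h)\<^sup>2) - a * (q * (s * (s + h)) + h\<^sup>2)\<bar> = \<bar>a * (h * (q * s)) + a * h\<^sup>2 * (q - 1)\<bar>"
      by (simp add: power2_eq_square algebra_simps)
    also have "\<dots> \<le> \<bar>a * (h * (q * s))\<bar> + a * h\<^sup>2 * \<bar>q - 1\<bar>"
      using assms by (intro order_trans[OF abs_triangle_ineq]) (simp add: abs_mult)
    also have "\<dots> \<le> (sqrt a * h) * (2 * m) + (sqrt a * h) * 5"
      using assms by (intro add_mono 1 mult_mono[OF t2]) auto
    finally have d: "\<bar>a * (q * (s + h)\<^sup>2) - a * (q * (s * (s + h)) + h\<^sup>2)\<bar> \<le> (sqrt a * h) * (2 * m + 5)"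
      by (simp add: algebra_simps)
    have "2 * m \<le> m\<^sup>2 + 1" using zero_le_power2[of "m - 1"] by (simp add: power2_diff)
    moreover have "2 * m + 5 \<le> 7 * (1 + X / 2)" if "2 * m \<le> X + 1" "0 \<le> X" for X
      using that by (simp add: field_simps)
    ultimately have "2 * m + 5 \<le> 7 * (1 + m\<^sup>2 / 2)" using zero_le_power2 by blast
    also have "\<dots> \<le> 7 * exp (m\<^sup>2 / 2)" by (intro mult_left_mono exp_ge_add_one_self) auto
    finally have e: "2 * m + 5 \<le> 7 * exp (m\<^sup>2 / 2)" .
    have "?l \<le> \<bar>a * (q * (s + h)\<^sup>2) - a * (q * (s * (s + h)) + h\<^sup>2)\<bar>
        * exp (- min (a * (q * (s + h)\<^sup>2)) (a * (q * (s * (s + h)) + h\<^sup>2)))"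
      by (rule abs_exp_minus_diff_le)
    also have "\<dots> \<le> (sqrt a * h) * (7 * exp (m\<^sup>2 / 2)) * exp (- m\<^sup>2)"
      using min assms by (intro mult_mono order_trans[OF d] mult_left_mono e) auto
    also have "\<dots> = 7 * (sqrt a * h) * exp (m\<^sup>2 / 2 + - m\<^sup>2)"
      unfolding exp_add by simp
    also have "m\<^sup>2 / 2 + - m\<^sup>2 = - (m\<^sup>2 / 2)" by simp
    finally show "?l \<le> 7 * ?v * (sqrt a * h)" unfolding v by (simp only: mult_ac)
  qed (use assms in auto)
  then show ?thesis by (simp only: mult_ac)
qed

text \<open>The two middle points of the mixed difference have the same norm, hence the coefficient
  2. With the exponents written as \<open>m + u1\<close>, \<open>m + u2\<close> and
  \<open>m\<close>, first-order expansion leaves \<open>u1 - 2 * u2\<close>, which is of order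
  \<open>a * h\<^sup>2\<close>, and remainders quadratic in \<open>u1\<close> and
  \<open>u2\<close>.\<close>

lemma cone_second_difference:
  fixes a h q s :: real
  assumes "0 < a" "0 < h" "0 \<le> s" "0 \<le> q" "q \<le> 4" "0 < \<rho>" "\<rho> \<le> 2"
  shows "\<bar>exp (- (a * (q * (s + h)\<^sup>2))) - 2 * exp (- (a * (q * (s * (s + h)) + h\<^sup>2))) + exp (- (a * (q * s\<^sup>2)))\<bar>
    \<le> 96 * (sqrt a * h) powr \<rho> * exp (- (a * s\<^sup>2 / 2 * q))" (is "?l \<le> _ * _ * ?v")
proof -
  define m where "m = a * s\<^sup>2 * q"
  define u1 where "u1 = a * q * (2 * s * h + h\<^sup>2)"
  define u2 where "u2 = a * q * s * h + a * h\<^sup>2"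
  have m: "0 \<le> m" and u: "0 \<le> u1" "0 \<le> u2" using assms by (auto simp: m_def u1_def u2_def)
  have eq: "a * (q * (s + h)\<^sup>2) = m + u1" "a * (q * (s * (s + h)) + h\<^sup>2) = m + u2" "a * (q * s\<^sup>2) = m"
    by (simp_all add: m_def u1_def u2_def power2_eq_square algebra_simps)
  have v: "?v = exp (- (m / 2))" by (simp add: m_def)
  have "?l \<le> (96 * ?v) * (a * h\<^sup>2) powr (\<rho> / 2)"
    unfolding eq
  proof (rule le_mult_powr_interpolate)
    have "\<bar>exp (- (m + u1)) - 2 * exp (- (m + u2)) + exp (- m)\<bar> \<le> exp (- (m + u1)) + 2 * exp (- (m + u2)) + exp (- m)"
      by (simp add: abs_if)
    also have "\<dots> \<le> exp (- (m / 2)) + 2 * exp (- (m / 2)) + exp (- (m / 2))"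
      using m u by (intro add_mono mult_left_mono) auto
    also have "\<dots> \<le> 96 * exp (- (m / 2))" by simp
    finally show "\<bar>exp (- (m + u1)) - 2 * exp (- (m + u2)) + exp (- m)\<bar> \<le> 96 * ?v" unfolding v .
  next
    assume t: "a * h\<^sup>2 \<le> 1"
    have t2: "(a * h\<^sup>2)\<^sup>2 \<le> a * h\<^sup>2"
      using t assms mult_left_mono[of "a * h\<^sup>2" 1 "a * h\<^sup>2"] by (simp add: power2_eq_square)
    \<comment> \<open>This is the part linear in \<open>h\<close>:
      \<open>u1 = 2 * g + a * q * h\<^sup>2\<close> and \<open>u2 = g + a * h\<^sup>2\<close>. Its
      square is \<open>a * h\<^sup>2\<close> times \<open>m * q\<close>, so it has the right order
      once half of the exponent pays for \<open>m\<close>.\<close>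
    define g where "g = a * q * s * h"
    have "g\<^sup>2 = a * h\<^sup>2 * m * q" by (simp add: g_def m_def power2_eq_square)
    also have "\<dots> \<le> a * h\<^sup>2 * m * 4" using assms m by (intro mult_left_mono) auto
    finally have g: "g\<^sup>2 \<le> 4 * (a * h\<^sup>2) * m" by simp
    have sq: "(x + y)\<^sup>2 \<le> 2 * x\<^sup>2 + 2 * y\<^sup>2" for x y :: real
      using zero_le_power2[of "x - y"] unfolding power2_diff power2_sum by linarith
    have "a * q * h\<^sup>2 \<le> 4 * (a * h\<^sup>2)" using assms by simp
    then have "u1 \<le> 2 * g + 4 * (a * h\<^sup>2)" by (simp add: u1_def g_def algebra_simps)
    then have "u1\<^sup>2 \<le> (2 * g + 4 * (a * h\<^sup>2))\<^sup>2" using u by (intro power_mono) auto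
    also have "\<dots> \<le> 8 * g\<^sup>2 + 32 * (a * h\<^sup>2)\<^sup>2" by (rule order_trans[OF sq]) (simp add: power_mult_distrib)
    finally have u1: "u1\<^sup>2 \<le> 8 * g\<^sup>2 + 32 * (a * h\<^sup>2)\<^sup>2" .
    have u2: "u2\<^sup>2 \<le> 2 * g\<^sup>2 + 2 * (a * h\<^sup>2)\<^sup>2" unfolding u2_def g_def by (rule sq)
    \<comment> \<open>the terms linear in \<open>h\<close> cancel\<close>
    have "u1 - 2 * u2 = a * h\<^sup>2 * (q - 2)" by (simp add: u1_def u2_def power2_eq_square algebra_simps)
    then have "\<bar>u1 - 2 * u2\<bar> = a * h\<^sup>2 * \<bar>q - 2\<bar>" using assms by (simp add: abs_mult)
    also have "\<dots> \<le> a * h\<^sup>2 * 2" using assms by (intro mult_left_mono) auto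
    finally have d: "\<bar>u1 - 2 * u2\<bar> \<le> 2 * (a * h\<^sup>2)" by simp
    have "\<bar>exp (- u1) - 2 * exp (- u2) + 1\<bar> \<le> \<bar>u1 - 2 * u2\<bar> + u1\<^sup>2 + 2 * u2\<^sup>2"
      using abs_exp_minus_remainder_le[OF u(1)] abs_exp_minus_remainder_le[OF u(2)] by linarith
    also have "\<dots> \<le> 38 * (a * h\<^sup>2) + 12 * g\<^sup>2" using d u1 u2 t2 by linarith
    also have "\<dots> \<le> a * h\<^sup>2 * (96 * (1 + m / 2))"
    proof -
      have "a * h\<^sup>2 * (96 * (1 + m / 2)) = 96 * (a * h\<^sup>2) + 12 * (4 * (a * h\<^sup>2) * m)"
        by (simp add: algebra_simps)
      moreover have "0 \<le> a * h\<^sup>2" using assms by simp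
      ultimately show ?thesis using g by linarith
    qed
    also have "\<dots> \<le> a * h\<^sup>2 * (96 * exp (m / 2))"
      using assms by (intro mult_left_mono exp_ge_add_one_self) auto
    finally have main: "\<bar>exp (- u1) - 2 * exp (- u2) + 1\<bar> \<le> a * h\<^sup>2 * (96 * exp (m / 2))" .
    have "exp (- (m + u1)) - 2 * exp (- (m + u2)) + exp (- m) = exp (- m) * (exp (- u1) - 2 * exp (- u2) + 1)"
      by (simp add: algebra_simps mult_exp_exp)
    then have "\<bar>exp (- (m + u1)) - 2 * exp (- (m + u2)) + exp (- m)\<bar> = exp (- m) * \<bar>exp (- u1) - 2 * exp (- u2) + 1\<bar>"
      by (simp add: abs_mult)
    also have "\<dots> \<le> exp (- m) * (a * h\<^sup>2 * (96 * exp (m / 2)))"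
      by (intro mult_left_mono main) auto
    also have "\<dots> = 96 * (a * h\<^sup>2) * exp (- m + m / 2)"
      unfolding exp_add by simp
    also have "- m + m / 2 = - (m / 2)" by simp
    finally show "\<bar>exp (- (m + u1)) - 2 * exp (- (m + u2)) + exp (- m)\<bar> \<le> 96 * ?v * (a * h\<^sup>2)"
      unfolding v by (simp only: mult_ac)
  qed (use assms in auto)
  also have "(a * h\<^sup>2) powr (\<rho> / 2) = (sqrt a * h) powr \<rho>"
    using assms by (auto simp: powr_mult powr_half_sqrt[symmetric] powr_powr simp flip: powr_numeral)
  finally show ?thesis by (simp only: mult_ac)
qed

section \<open>The Bessel kernel as a mixture of Gaussians\<close>

definition bessel_weight :: "real \<Rightarrow> real \<Rightarrow> real" where
  "bessel_weight \<alpha> w = indicator {0<..} w * (w powr ((\<alpha> - 5) / 2) * exp (- w))"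

lemma bessel_weight_nonneg [simp]: "0 \<le> bessel_weight \<alpha> w"
  by (simp add: bessel_weight_def)

lemma borel_measurable_bessel_weight [measurable]: "bessel_weight \<alpha> \<in> borel_measurable borel"
  unfolding bessel_weight_def by measurable

text \<open>Euler's integral at the argument \<open>p + (\<alpha> - 3) / 2\<close>. For
  \<open>p = 1 - \<gamma> / 2\<close> this argument is positive exactly when
  \<open>\<gamma> < \<alpha> - 1\<close>, which is where the threshold on the exponents
  arises.\<close>

lemma nn_integral_bessel_weight_powr:
  assumes "0 < p + (\<alpha> - 3) / 2"
  shows "(\<integral>\<^sup>+w. ennreal (bessel_weight \<alpha> w * w powr p) \<partial>lborel) = ennreal (Gamma (p + (\<alpha> - 3) / 2))"
proof -
  have "ennreal (bessel_weight \<alpha> w * w powr p)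
      = ennreal (indicator {0..} w * w powr (p + (\<alpha> - 3) / 2 - 1) / exp w)" if "w \<noteq> 0" for w
  proof -
    have "w powr ((\<alpha> - 5) / 2) * w powr p = w powr (p + (\<alpha> - 3) / 2 - 1)"
      by (simp add: powr_add[symmetric] field_simps)
    with that show ?thesis
      by (simp add: bessel_weight_def indicator_def exp_minus field_simps)
  qed
  then show ?thesis
    unfolding Gamma_conv_nn_integral_real[OF assms]
    by (intro nn_integral_cong_AE eventually_mono[OF AE_lborel_singleton[of 0]]) simp
qed

text \<open>The bound \<open>exp (- c) \<le> 1 / c\<close> gains one power of \<open>w\<close> near
  0, and then \<open>1 < \<alpha>\<close> suffices for convergence. At the origin nothing is gained
  and the kernel may be the default value 0, so the representation is applied only off null
  sets.\<close>

lemma has_bochner_integral_bessel_kernel: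
  assumes "1 < \<alpha>" "x \<noteq> 0"
  shows "has_bochner_integral lborel
    (\<lambda>w. bessel_weight \<alpha> w * exp (- (1 / (4 * w) * (norm x)\<^sup>2))) (bessel_kernel \<alpha> x)"
proof -
  let ?F = "\<lambda>w. bessel_weight \<alpha> w * exp (- (1 / (4 * w) * (norm x)\<^sup>2))"
  have "integrable lborel ?F"
  proof (rule integrableI_nonneg)
    have "?F w \<le> 4 / (norm x)\<^sup>2 * (bessel_weight \<alpha> w * w powr 1)" for w
    proof (cases "0 < w")
      case True
      define c where "c = (norm x)\<^sup>2 / (4 * w)"
      have c: "0 < c" using assms True by (simp add: c_def)
      have "exp (- c) \<le> 1 / c"
      proof -
        have "c \<le> exp c" using exp_ge_add_one_self[of c] by linarith
        with c show ?thesis by (simp add: exp_minus field_simps)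
      qed
      also have "1 / c = 4 / (norm x)\<^sup>2 * w powr 1" using True by (simp add: c_def)
      finally have "bessel_weight \<alpha> w * exp (- c) \<le> bessel_weight \<alpha> w * (4 / (norm x)\<^sup>2 * w powr 1)"
        by (intro mult_left_mono) auto
      then show ?thesis by (simp add: c_def mult_ac)
    qed (simp add: bessel_weight_def)
    then have "(\<integral>\<^sup>+w. ennreal (?F w) \<partial>lborel)
        \<le> (\<integral>\<^sup>+w. ennreal (4 / (norm x)\<^sup>2) * ennreal (bessel_weight \<alpha> w * w powr 1) \<partial>lborel)"
      by (intro nn_integral_mono) (simp add: ennreal_mult[symmetric] ennreal_leI)
    also have "\<dots> = ennreal (4 / (norm x)\<^sup>2) * ennreal (Gamma (1 + (\<alpha> - 3) / 2))"
      using assms by (subst nn_integral_cmult, measurable)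
        (subst nn_integral_bessel_weight_powr, auto simp: field_simps)
    also have "\<dots> < \<infinity>" by (simp add: ennreal_mult_less_top)
    finally show "(\<integral>\<^sup>+w. ennreal (?F w) \<partial>lborel) < \<infinity>" .
  qed auto
  moreover have "integral\<^sup>L lborel ?F = bessel_kernel \<alpha> x"
    unfolding bessel_kernel_def set_lebesgue_integral_def bessel_weight_def
    by (intro Bochner_Integration.integral_cong) auto
  ultimately show ?thesis by (simp add: has_bochner_integral_iff)
qed

lemma bessel_kernel_nonneg: "0 \<le> bessel_kernel \<alpha> x"
  unfolding bessel_kernel_def set_lebesgue_integral_def by (intro integral_nonneg_AE) auto

text \<open>In use \<open>r\<close> is a finite difference of the kernel and \<phi> the same
  difference of Gaussians, so cancellation is kept under the integral; \<open>c\<close> is the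
  weight \<open>1 / norm z\<close>, \<open>s\<close> or \<open>s\<^sup>2\<close>.\<close>

lemma abs_le_nn_integral_bessel_weight:
  assumes "has_bochner_integral lborel (\<lambda>w. bessel_weight \<alpha> w * \<phi> w) r" "0 \<le> c"
  shows "ennreal (\<bar>r\<bar> * c) \<le> (\<integral>\<^sup>+w. ennreal (bessel_weight \<alpha> w) * ennreal (\<bar>\<phi> w\<bar> * c) \<partial>lborel)"
proof -
  have "has_bochner_integral lborel (\<lambda>w. bessel_weight \<alpha> w * \<phi> w * c) (r * c)"
    using assms(1) by (rule has_bochner_integral_mult_left)
  then show ?thesis
    using integral_norm_bound_ennreal[of lborel "\<lambda>w. bessel_weight \<alpha> w * \<phi> w * c"] assms(2)
    by (simp add: has_bochner_integral_iff abs_mult ennreal_mult mult.assoc)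
qed

text \<open>Common reduction of all estimates: Tonelli moves the \<open>w\<close>-integral outside,
  a single Gaussian contributes a power of \<open>w\<close>, and a Gamma integral remains. The bound
  on \<open>L\<close> is asked for almost everywhere because the mixture formula is available only
  away from the origin.\<close>

lemma nn_integral_bessel_mixture:
  fixes \<Phi> :: "'a \<Rightarrow> real \<Rightarrow> ennreal"
  assumes "sigma_finite_measure M"
    and meas [measurable]: "case_prod \<Phi> \<in> borel_measurable (M \<Otimes>\<^sub>M lborel)"
    and L: "AE z in M. L z \<le> (\<integral>\<^sup>+w. ennreal (bessel_weight \<alpha> w) * \<Phi> z w \<partial>lborel)"
    and B: "\<And>w. 0 < w \<Longrightarrow> (\<integral>\<^sup>+z. \<Phi> z w \<partial>M) \<le> ennreal (B * w powr p)" "0 \<le> B"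
    and p: "0 < p + (\<alpha> - 3) / 2"
  shows "(\<integral>\<^sup>+z. L z \<partial>M) \<le> ennreal (B * Gamma (p + (\<alpha> - 3) / 2))"
proof -
  interpret M: sigma_finite_measure M by fact
  interpret pair_sigma_finite M lborel by standard
  have "(\<integral>\<^sup>+z. L z \<partial>M) \<le> (\<integral>\<^sup>+z. (\<integral>\<^sup>+w. ennreal (bessel_weight \<alpha> w) * \<Phi> z w \<partial>lborel) \<partial>M)"
    using L by (rule nn_integral_mono_AE)
  also have "\<dots> = (\<integral>\<^sup>+w. (\<integral>\<^sup>+z. ennreal (bessel_weight \<alpha> w) * \<Phi> z w \<partial>M) \<partial>lborel)"
    by (rule Fubini'[symmetric]) measurable
  also have "\<dots> \<le> (\<integral>\<^sup>+w. ennreal B * ennreal (bessel_weight \<alpha> w * w powr p) \<partial>lborel)"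
  proof (rule nn_integral_mono)
    fix w :: real
    have "(\<lambda>z. \<Phi> z w) \<in> borel_measurable M" by measurable
    then have "(\<integral>\<^sup>+z. ennreal (bessel_weight \<alpha> w) * \<Phi> z w \<partial>M) = ennreal (bessel_weight \<alpha> w) * (\<integral>\<^sup>+z. \<Phi> z w \<partial>M)"
      by (rule nn_integral_cmult)
    also have "\<dots> \<le> ennreal (bessel_weight \<alpha> w) * ennreal (B * w powr p)"
    proof (cases "0 < w")
      case True
      then show ?thesis by (intro mult_left_mono B) auto
    qed (simp add: bessel_weight_def)
    also have "\<dots> = ennreal B * ennreal (bessel_weight \<alpha> w * w powr p)"
      using \<open>0 \<le> B\<close> by (simp add: ennreal_mult[symmetric] mult_ac)
    finally show "(\<integral>\<^sup>+z. ennreal (bessel_weight \<alpha> w) * \<Phi> z w \<partial>M) \<le> ennreal B * ennreal (bessel_weight \<alpha> w * w powr p)" .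
  qed
  also have "\<dots> = ennreal B * ennreal (Gamma (p + (\<alpha> - 3) / 2))"
    using p by (subst nn_integral_cmult) (auto simp: nn_integral_bessel_weight_powr)
  also have "\<dots> = ennreal (B * Gamma (p + (\<alpha> - 3) / 2))"
    using p \<open>0 \<le> B\<close> by (simp add: ennreal_mult[symmetric] Gamma_real_pos less_imp_le)
  finally show ?thesis .
qed

text \<open>Translates the Gaussian parameter \<open>a = 1 / (4 * w)\<close> back to
  \<open>w\<close>. The space integrals use \<open>\<theta> = 1\<close>, from their factor
  \<open>1 / a\<close>; the sphere integrals use \<open>\<theta> < 1\<close>.\<close>

lemma powr_scale:
  assumes "0 < w" "0 \<le> d"
  shows "(sqrt (1 / (4 * w)) * d) powr \<gamma> * (1 / (4 * w)) powr (- \<theta>)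
    = 4 powr (\<theta> - \<gamma> / 2) * d powr \<gamma> * w powr (\<theta> - \<gamma> / 2)"
proof -
  have "(sqrt (1 / (4 * w)) * d) powr \<gamma> = (1 / (4 * w)) powr (\<gamma> / 2) * d powr \<gamma>"
    using assms by (simp add: powr_mult powr_half_sqrt[symmetric] powr_powr)
  then have "(sqrt (1 / (4 * w)) * d) powr \<gamma> * (1 / (4 * w)) powr (- \<theta>) = d powr \<gamma> * (1 / (4 * w)) powr (\<gamma> / 2 - \<theta>)"
    by (simp add: powr_add[symmetric])
  also have "(1 / (4 * w)) powr (\<gamma> / 2 - \<theta>) = (4 * w) powr (\<theta> - \<gamma> / 2)"
    using assms powr_minus[of "4 * w" "\<theta> - \<gamma> / 2"] by (simp add: powr_divide inverse_eq_divide)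
  finally show ?thesis
    using assms by (simp add: powr_mult)
qed

section \<open>Estimates for the Bessel kernel\<close>

text \<open>The parameter \<open>a / 4\<close> gives \<open>16 * pi / a\<close> for each of the
  three translates, hence the 48.\<close>

lemma nn_integral_gaussian_dominated_over_norm:
  fixes y :: "real^3" and G :: "real^3 \<Rightarrow> real"
  assumes "0 < a" "0 \<le> K"
    and G: "\<And>z. G z \<le> K * (exp (- (a / 4 * (norm (z + y))\<^sup>2)) + exp (- (a / 4 * (norm (z - y))\<^sup>2)) + exp (- (a / 4 * (norm z)\<^sup>2)))"
  shows "(\<integral>\<^sup>+z. ennreal (G z / norm z) \<partial>lborel) \<le> ennreal (48 * pi * K / a)"
proof -
  let ?g = "\<lambda>v z :: real^3. ennreal (exp (- (a / 4 * (norm (z + v))\<^sup>2)) / norm z)"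
  have g: "(\<integral>\<^sup>+z. ?g v z \<partial>lborel) \<le> ennreal (16 * pi / a)" for v
    using nn_integral_shifted_gaussian_over_norm[of "a / 4" v] \<open>0 < a\<close> by simp
  have "ennreal (G z / norm z) \<le> ennreal K * (?g y z + ?g (- y) z + ?g 0 z)" for z
    using divide_right_mono[OF G[of z], of "norm z"] \<open>0 \<le> K\<close>
    by (simp add: ennreal_plus[symmetric] ennreal_mult[symmetric] add_divide_distrib[symmetric] ennreal_leI
          del: ennreal_plus)
  then have "(\<integral>\<^sup>+z. ennreal (G z / norm z) \<partial>lborel) \<le> (\<integral>\<^sup>+z. ennreal K * (?g y z + ?g (- y) z + ?g 0 z) \<partial>lborel)"
    by (rule nn_integral_mono)
  also have "\<dots> = ennreal K * ((\<integral>\<^sup>+z. ?g y z \<partial>lborel) + (\<integral>\<^sup>+z. ?g (- y) z \<partial>lborel) + (\<integral>\<^sup>+z. ?g 0 z \<partial>lborel))"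
    by (simp add: nn_integral_cmult nn_integral_add)
  also have "\<dots> \<le> ennreal K * (ennreal (16 * pi / a) + ennreal (16 * pi / a) + ennreal (16 * pi / a))"
    by (intro mult_left_mono add_mono g) auto
  also have "\<dots> = ennreal (48 * pi * K / a)"
    using assms by (simp add: ennreal_plus[symmetric] ennreal_mult[symmetric] del: ennreal_plus)
  finally show ?thesis .
qed

text \<open>A single Gaussian contributes a multiple of
  \<open>(sqrt a * norm y) powr \<gamma> / a\<close>, that is, the power
  \<open>p = 1 - \<gamma> / 2\<close> of \<open>w\<close>. The integral runs over the whole space,
  so the constant does not involve \<open>T\<close>.\<close>

lemma bessel_kernel_first_difference:
  assumes "1 < \<alpha>" "0 < \<gamma>" "\<gamma> < \<alpha> - 1" "\<gamma> \<le> 1"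
  shows "\<exists>C\<ge>0. \<forall>y. (\<integral>\<^sup>+z. ennreal (\<bar>bessel_kernel \<alpha> (z + y) - bessel_kernel \<alpha> z\<bar> / norm z) \<partial>lborel)
    \<le> ennreal (C * norm y powr \<gamma>)"
proof -
  define p where "p = 1 - \<gamma> / 2"
  have p: "0 < p + (\<alpha> - 3) / 2" using assms by (simp add: p_def field_simps)
  define K where "K = 48 * pi * (5 * exp 1) * 4 powr p"
  have K: "0 \<le> K" by (simp add: K_def)
  have "(\<integral>\<^sup>+z. ennreal (\<bar>bessel_kernel \<alpha> (z + y) - bessel_kernel \<alpha> z\<bar> / norm z) \<partial>lborel)
    \<le> ennreal (K * norm y powr \<gamma> * Gamma (p + (\<alpha> - 3) / 2))" for y
  proof (rule nn_integral_bessel_mixture[OF sigma_finite_lborel])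
    let ?E = "\<lambda>w z. exp (- (1 / (4 * w) * (norm (z :: real^3))\<^sup>2))"
    show "(\<lambda>(z, w). ennreal (\<bar>?E w (z + y) - ?E w z\<bar> / norm z)) \<in> borel_measurable (lborel \<Otimes>\<^sub>M lborel)"
      by measurable
    show "AE z in lborel. ennreal (\<bar>bessel_kernel \<alpha> (z + y) - bessel_kernel \<alpha> z\<bar> / norm z)
        \<le> (\<integral>\<^sup>+w. ennreal (bessel_weight \<alpha> w) * ennreal (\<bar>?E w (z + y) - ?E w z\<bar> / norm z) \<partial>lborel)"
      \<comment> \<open>The mixture formula needs both \<open>z\<close> and \<open>z + y\<close> to
        be nonzero.\<close>
      using AE_lborel_singleton[of 0] AE_lborel_singleton[of "- y"]
    proof eventually_elim
      case (elim z)
      then have "z + y \<noteq> 0" by (metis eq_neg_iff_add_eq_0)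
      with elim \<open>1 < \<alpha>\<close> show ?case
        using abs_le_nn_integral_bessel_weight[where c = "1 / norm z", OF has_bochner_integral_diff[OF
              has_bochner_integral_bessel_kernel[of \<alpha> "z + y"] has_bochner_integral_bessel_kernel[of \<alpha> z],
              unfolded right_diff_distrib[symmetric]]]
        by simp
    qed
    show "(\<integral>\<^sup>+z. ennreal (\<bar>?E w (z + y) - ?E w z\<bar> / norm z) \<partial>lborel) \<le> ennreal (K * norm y powr \<gamma> * w powr p)"
      if w: "0 < w" for w
    proof -
      define a where "a = 1 / (4 * w)"
      have a: "0 < a" using w by (simp add: a_def)
      have "(\<integral>\<^sup>+z. ennreal (\<bar>?E w (z + y) - ?E w z\<bar> / norm z) \<partial>lborel)
          \<le> ennreal (48 * pi * (5 * exp 1 * (sqrt a * norm y) powr \<gamma>) / a)"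
        unfolding a_def[symmetric]
      proof (rule nn_integral_gaussian_dominated_over_norm[where y = y])
        fix z
        have "\<bar>exp (- (a * (norm (z + y))\<^sup>2)) - exp (- (a * (norm z)\<^sup>2))\<bar> \<le> 5 * exp 1 * (sqrt a * norm y) powr \<gamma>
            * (exp (- (a / 4 * (norm (z + y))\<^sup>2)) + exp (- (a / 4 * (norm z)\<^sup>2)))"
          by (rule gaussian_first_difference) (use a assms in auto)
        \<comment> \<open>A third Gaussian is added so that first and second differences share one
          domination lemma.\<close>
        also have "\<dots> \<le> 5 * exp 1 * (sqrt a * norm y) powr \<gamma>
            * (exp (- (a / 4 * (norm (z + y))\<^sup>2)) + exp (- (a / 4 * (norm (z - y))\<^sup>2)) + exp (- (a / 4 * (norm z)\<^sup>2)))"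
          by (intro mult_left_mono) auto
        finally show "\<bar>exp (- (a * (norm (z + y))\<^sup>2)) - exp (- (a * (norm z)\<^sup>2))\<bar> \<le> 5 * exp 1 * (sqrt a * norm y) powr \<gamma>
            * (exp (- (a / 4 * (norm (z + y))\<^sup>2)) + exp (- (a / 4 * (norm (z - y))\<^sup>2)) + exp (- (a / 4 * (norm z)\<^sup>2)))" .
      qed (use a in auto)
      also have "48 * pi * (5 * exp 1 * (sqrt a * norm y) powr \<gamma>) / a
          = 48 * pi * (5 * exp 1) * ((sqrt a * norm y) powr \<gamma> * a powr - 1)"
        using a by (simp add: powr_minus_divide)
      also have "\<dots> = K * norm y powr \<gamma> * w powr p"
        unfolding a_def using w by (subst powr_scale) (auto simp: K_def p_def)
      finally show ?thesis .
    qed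
  qed (use K p in auto)
  moreover have "0 \<le> K * Gamma (p + (\<alpha> - 3) / 2)" using K p by (simp add: Gamma_real_pos less_imp_le)
  ultimately show ?thesis
    by (intro exI[of _ "K * Gamma (p + (\<alpha> - 3) / 2)"]) (simp add: mult_ac)
qed

text \<open>Same scheme as for the first difference: the Gaussian estimate now allows \<gamma> up to
  2, while convergence of the Gamma integral still asks for
  \<open>\<gamma> < \<alpha> - 1\<close>.\<close>

lemma bessel_kernel_second_difference:
  assumes "1 < \<alpha>" "0 < \<gamma>" "\<gamma> < \<alpha> - 1" "\<gamma> \<le> 2"
  shows "\<exists>C\<ge>0. \<forall>y. (\<integral>\<^sup>+z. ennreal (\<bar>bessel_kernel \<alpha> (z + y) + bessel_kernel \<alpha> (z - y) - 2 * bessel_kernel \<alpha> z\<bar> / norm z) \<partial>lborel)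
    \<le> ennreal (C * norm y powr \<gamma>)"
proof -
  define p where "p = 1 - \<gamma> / 2"
  have p: "0 < p + (\<alpha> - 3) / 2" using assms by (simp add: p_def field_simps)
  define K where "K = 48 * pi * (16 * exp 4) * 4 powr p"
  have K: "0 \<le> K" by (simp add: K_def)
  have "(\<integral>\<^sup>+z. ennreal (\<bar>bessel_kernel \<alpha> (z + y) + bessel_kernel \<alpha> (z - y) - 2 * bessel_kernel \<alpha> z\<bar> / norm z) \<partial>lborel)
    \<le> ennreal (K * norm y powr \<gamma> * Gamma (p + (\<alpha> - 3) / 2))" for y
  proof (rule nn_integral_bessel_mixture[OF sigma_finite_lborel])
    let ?E = "\<lambda>w z. exp (- (1 / (4 * w) * (norm (z :: real^3))\<^sup>2))"
    let ?D = "\<lambda>w z. ?E w (z + y) + ?E w (z - y) - 2 * ?E w z"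
    show "(\<lambda>(z, w). ennreal (\<bar>?D w z\<bar> / norm z)) \<in> borel_measurable (lborel \<Otimes>\<^sub>M lborel)"
      by measurable
    show "AE z in lborel. ennreal (\<bar>bessel_kernel \<alpha> (z + y) + bessel_kernel \<alpha> (z - y) - 2 * bessel_kernel \<alpha> z\<bar> / norm z)
        \<le> (\<integral>\<^sup>+w. ennreal (bessel_weight \<alpha> w) * ennreal (\<bar>?D w z\<bar> / norm z) \<partial>lborel)"
      using AE_lborel_singleton[of 0] AE_lborel_singleton[of "- y"] AE_lborel_singleton[of y]
    proof eventually_elim
      case (elim z)
      then have ne: "z + y \<noteq> 0" "z - y \<noteq> 0" "z \<noteq> 0" by (auto simp: eq_neg_iff_add_eq_0)
      have "has_bochner_integral lborel (\<lambda>w. bessel_weight \<alpha> w * ?D w z)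
          (bessel_kernel \<alpha> (z + y) + bessel_kernel \<alpha> (z - y) - 2 * bessel_kernel \<alpha> z)"
        using has_bochner_integral_diff[OF has_bochner_integral_add[OF
              has_bochner_integral_bessel_kernel[OF \<open>1 < \<alpha>\<close> ne(1)] has_bochner_integral_bessel_kernel[OF \<open>1 < \<alpha>\<close> ne(2)]]
            has_bochner_integral_mult_right[where c=2, OF has_bochner_integral_bessel_kernel[OF \<open>1 < \<alpha>\<close> ne(3)]]]
        by (simp add: algebra_simps)
      from abs_le_nn_integral_bessel_weight[OF this, of "1 / norm z"] show ?case by simp
    qed
    show "(\<integral>\<^sup>+z. ennreal (\<bar>?D w z\<bar> / norm z) \<partial>lborel) \<le> ennreal (K * norm y powr \<gamma> * w powr p)"
      if w: "0 < w" for w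
    proof -
      define a where "a = 1 / (4 * w)"
      have a: "0 < a" using w by (simp add: a_def)
      have "(\<integral>\<^sup>+z. ennreal (\<bar>?D w z\<bar> / norm z) \<partial>lborel)
          \<le> ennreal (48 * pi * (16 * exp 4 * (sqrt a * norm y) powr \<gamma>) / a)"
        unfolding a_def[symmetric]
        by (rule nn_integral_gaussian_dominated_over_norm[where y = y], fact, simp, rule gaussian_second_difference)
           (use a assms in auto)
      also have "48 * pi * (16 * exp 4 * (sqrt a * norm y) powr \<gamma>) / a
          = 48 * pi * (16 * exp 4) * ((sqrt a * norm y) powr \<gamma> * a powr - 1)"
        using a by (simp add: powr_minus_divide)
      also have "\<dots> = K * norm y powr \<gamma> * w powr p"
        unfolding a_def using w by (subst powr_scale) (auto simp: K_def p_def)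
      finally show ?thesis .
    qed
  qed (use K p in auto)
  moreover have "0 \<le> K * Gamma (p + (\<alpha> - 3) / 2)" using K p by (simp add: Gamma_real_pos less_imp_le)
  ultimately show ?thesis
    by (intro exI[of _ "K * Gamma (p + (\<alpha> - 3) / 2)"]) (simp add: mult_ac)
qed

text \<open>On the ball the indicator is at most
  \<open>exp 1 * exp (- (norm z)\<^sup>2 / h\<^sup>2)\<close>, so the parameter grows to
  \<open>a + 1 / h\<^sup>2\<close>. Its reciprocal is at most \<open>1 / a\<close> and at most
  \<open>h\<^sup>2\<close>, and these two bounds are interpolated.\<close>

lemma nn_integral_gaussian_over_norm_cball:
  assumes "0 < a" "0 < h" "0 < \<nu>" "\<nu> \<le> 2"
  shows "(\<integral>\<^sup>+(z::real^3)\<in>cball 0 h. ennreal (exp (- (a * (norm z)\<^sup>2)) / norm z) \<partial>lborel)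
    \<le> ennreal (2 * pi * exp 1 / a * (sqrt a * h) powr \<nu>)"
proof -
  let ?b = "a + 1 / h\<^sup>2"
  have b: "0 < ?b" using assms by (simp add: add_pos_pos)
  have "ennreal (exp (- (a * (norm z)\<^sup>2)) / norm z) * indicator (cball 0 h) z
      \<le> ennreal (exp 1) * ennreal (exp (- (?b * (norm z)\<^sup>2)) / norm z)" for z :: "real^3"
  proof (cases "norm z \<le> h")
    case True
    then have "(norm z)\<^sup>2 \<le> h\<^sup>2" by (intro power_mono) auto
    then have "1 / h\<^sup>2 * (norm z)\<^sup>2 \<le> 1" using assms by (simp add: field_simps)
    then have "exp (- (a * (norm z)\<^sup>2)) \<le> exp (1 + - (?b * (norm z)\<^sup>2))"
      by (simp add: algebra_simps)
    then have "exp (- (a * (norm z)\<^sup>2)) \<le> exp 1 * exp (- (?b * (norm z)\<^sup>2))"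
      unfolding exp_add .
    then have "exp (- (a * (norm z)\<^sup>2)) / norm z \<le> exp 1 * (exp (- (?b * (norm z)\<^sup>2)) / norm z)"
      using divide_right_mono[of _ _ "norm z"] by fastforce
    then show ?thesis using True by (simp add: ennreal_mult[symmetric] ennreal_leI)
  qed (simp add: indicator_def)
  then have "(\<integral>\<^sup>+(z::real^3)\<in>cball 0 h. ennreal (exp (- (a * (norm z)\<^sup>2)) / norm z) \<partial>lborel)
      \<le> (\<integral>\<^sup>+(z::real^3). ennreal (exp 1) * ennreal (exp (- (?b * (norm z)\<^sup>2)) / norm z) \<partial>lborel)"
    by (rule nn_integral_mono)
  also have "\<dots> = ennreal (exp 1 * (2 * pi / ?b))"
    using b by (subst nn_integral_cmult) (auto simp: nn_integral_gaussian_over_norm ennreal_mult'[symmetric])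
  also have "\<dots> \<le> ennreal (2 * pi * exp 1 / a * (sqrt a * h) powr \<nu>)"
  proof (rule ennreal_leI)
    have "exp 1 * (2 * pi / ?b) \<le> 2 * pi * exp 1 / a * (a * h\<^sup>2) powr (\<nu> / 2)"
    proof (rule le_mult_powr_interpolate)
      have "2 * pi * exp 1 / ?b \<le> 2 * pi * exp 1 / a"
        using assms b by (intro divide_left_mono) auto
      then show "exp 1 * (2 * pi / ?b) \<le> 2 * pi * exp 1 / a" by (simp add: mult_ac)
      have "2 * pi * exp 1 / ?b \<le> 2 * pi * exp 1 / (1 / h\<^sup>2)"
        using assms b by (intro divide_left_mono) auto
      then show "exp 1 * (2 * pi / ?b) \<le> 2 * pi * exp 1 / a * (a * h\<^sup>2)"
        using assms by (simp add: mult_ac)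
    qed (use assms in auto)
    also have "(a * h\<^sup>2) powr (\<nu> / 2) = (sqrt a * h) powr \<nu>"
      using assms by (auto simp: powr_mult powr_half_sqrt[symmetric] powr_powr simp flip: powr_numeral)
    finally show "exp 1 * (2 * pi / ?b) \<le> 2 * pi * exp 1 / a * (sqrt a * h) powr \<nu>" .
  qed
  finally show ?thesis .
qed

lemma bessel_kernel_over_norm_cball:
  assumes "1 < \<alpha>" "0 < \<nu>" "\<nu> < \<alpha> - 1" "\<nu> \<le> 2"
  shows "\<exists>C\<ge>0. \<forall>h>0. (\<integral>\<^sup>+(z::real^3)\<in>cball 0 h. ennreal (bessel_kernel \<alpha> z / norm z) \<partial>lborel)
    \<le> ennreal (C * h powr \<nu>)"
proof -
  define p where "p = 1 - \<nu> / 2"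
  have p: "0 < p + (\<alpha> - 3) / 2" using assms by (simp add: p_def field_simps)
  define K where "K = 2 * pi * exp 1 * 4 powr p"
  have K: "0 \<le> K" by (simp add: K_def)
  have "(\<integral>\<^sup>+z\<in>cball 0 h. ennreal (bessel_kernel \<alpha> z / norm z) \<partial>lborel)
    \<le> ennreal (K * h powr \<nu> * Gamma (p + (\<alpha> - 3) / 2))" if h: "0 < h" for h
  proof (rule nn_integral_bessel_mixture[OF sigma_finite_lborel])
    let ?E = "\<lambda>w z. exp (- (1 / (4 * w) * (norm (z :: real^3))\<^sup>2))"
    have [measurable]: "cball (0 :: real^3) h \<in> sets borel" by simp
    show "(\<lambda>(z, w). ennreal (?E w z / norm z) * indicator (cball 0 h) z) \<in> borel_measurable (lborel \<Otimes>\<^sub>M lborel)"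
      by measurable
    show "AE z in lborel. ennreal (bessel_kernel \<alpha> z / norm z) * indicator (cball 0 h) z
        \<le> (\<integral>\<^sup>+w. ennreal (bessel_weight \<alpha> w) * (ennreal (?E w z / norm z) * indicator (cball 0 h) z) \<partial>lborel)"
      using AE_lborel_singleton[of 0]
    proof eventually_elim
      case (elim z)
      from abs_le_nn_integral_bessel_weight[OF has_bochner_integral_bessel_kernel[OF \<open>1 < \<alpha>\<close> elim], of "1 / norm z"]
      show ?case by (cases "z \<in> cball 0 h") (auto simp: bessel_kernel_nonneg)
    qed
    show "(\<integral>\<^sup>+z\<in>cball 0 h. ennreal (?E w z / norm z) \<partial>lborel) \<le> ennreal (K * h powr \<nu> * w powr p)"
      if w: "0 < w" for w
    proof -
      define a where "a = 1 / (4 * w)"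
      have a: "0 < a" using w by (simp add: a_def)
      have "(\<integral>\<^sup>+z\<in>cball 0 h. ennreal (?E w z / norm z) \<partial>lborel)
          \<le> ennreal (2 * pi * exp 1 / a * (sqrt a * h) powr \<nu>)"
        unfolding a_def[symmetric] by (rule nn_integral_gaussian_over_norm_cball) (use a h assms in auto)
      also have "2 * pi * exp 1 / a * (sqrt a * h) powr \<nu> = 2 * pi * exp 1 * ((sqrt a * h) powr \<nu> * a powr - 1)"
        using a by (simp add: powr_minus_divide)
      also have "\<dots> = K * h powr \<nu> * w powr p"
        unfolding a_def using w h by (subst powr_scale) (auto simp: K_def p_def)
      finally show ?thesis .
    qed
  qed (use K p h in auto)
  moreover have "0 \<le> K * Gamma (p + (\<alpha> - 3) / 2)" using K p by (simp add: Gamma_real_pos less_imp_le)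
  ultimately show ?thesis
    by (intro exI[of _ "K * Gamma (p + (\<alpha> - 3) / 2)"]) (simp add: mult_ac)
qed

text \<open>A point mass at \<open>- \<eta>\<close> would stay below the integral of every Gaussian
  centred there, and these integrals tend to 0 as the parameter grows.\<close>

lemma AE_sphere_measure_add_neq_0:
  assumes \<eta>: "norm \<eta> = 1"
  shows "AE \<xi> in sphere_measure. \<xi> + \<eta> \<noteq> 0"
proof -
  interpret finite_measure sphere_measure by (rule finite_measure_sphere_measure)
  have sets: "{- \<eta>} \<in> sets sphere_measure"
    using \<eta> by (auto simp: sets_sphere_measure sets_restrict_space intro!: image_eqI[of _ _ "{- \<eta>}"])
  define m where "m = measure sphere_measure {- \<eta>}"
  define K where "K = 12 * exp 1 * pi * sqrt pi"
  have K: "0 < K" by (simp add: K_def)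
  have le: "m \<le> K / c" if "0 < c" for c
  proof -
    have "ennreal m = (\<integral>\<^sup>+\<xi>. indicator {- \<eta>} \<xi> \<partial>sphere_measure)"
      using sets by (simp add: m_def emeasure_eq_measure)
    also have "\<dots> \<le> (\<integral>\<^sup>+\<xi>. ennreal (exp (- (c * (norm (\<xi> + \<eta>))\<^sup>2))) \<partial>sphere_measure)"
      by (intro nn_integral_mono) (auto simp: indicator_def)
    also have "\<dots> \<le> ennreal (K * c powr - 1)"
      unfolding K_def using that by (intro nn_integral_sphere_gaussian \<eta>) auto
    finally show ?thesis using that K by (simp add: powr_minus_divide)
  qed
  have "m = 0"
  proof (rule ccontr)
    assume "m \<noteq> 0"
    then have "0 < m" by (simp add: m_def zero_less_measure_iff)
    \<comment> \<open>This choice of the parameter would give \<open>m \<le> m / 2\<close>.\<close>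
    then show False using le[of "2 * K / m"] K by simp
  qed
  then have "{- \<eta>} \<in> null_sets sphere_measure"
    using sets by (auto simp: null_sets_def m_def emeasure_eq_measure)
  then show ?thesis
    by (rule AE_I') (auto simp: eq_neg_iff_add_eq_0)
qed

section \<open>Integrals over the sphere and over the radius\<close>

lemma norm_cone_points:
  fixes \<xi> \<eta> :: "'a::real_inner"
  assumes "norm \<xi> = 1" "norm \<eta> = 1"
  shows "(norm (s *\<^sub>R (\<xi> + \<eta>) + h *\<^sub>R (\<xi> + \<eta>)))\<^sup>2 = (norm (\<xi> + \<eta>))\<^sup>2 * (s + h)\<^sup>2"
    and "(norm (s *\<^sub>R (\<xi> + \<eta>) + h *\<^sub>R \<xi>))\<^sup>2 = (norm (\<xi> + \<eta>))\<^sup>2 * (s * (s + h)) + h\<^sup>2"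
    and "(norm (s *\<^sub>R (\<xi> + \<eta>) + h *\<^sub>R \<eta>))\<^sup>2 = (norm (\<xi> + \<eta>))\<^sup>2 * (s * (s + h)) + h\<^sup>2"
    and "(norm (s *\<^sub>R (\<xi> + \<eta>)))\<^sup>2 = (norm (\<xi> + \<eta>))\<^sup>2 * s\<^sup>2"
    and "(norm (\<xi> + \<eta>))\<^sup>2 \<le> 4"
proof -
  have i: "\<xi> \<bullet> \<xi> = 1" "\<eta> \<bullet> \<eta> = 1" using assms by (simp_all add: dot_square_norm)
  show "(norm (s *\<^sub>R (\<xi> + \<eta>) + h *\<^sub>R (\<xi> + \<eta>)))\<^sup>2 = (norm (\<xi> + \<eta>))\<^sup>2 * (s + h)\<^sup>2"
    by (simp add: scaleR_add_left[symmetric] power_mult_distrib mult.commute)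
  show "(norm (s *\<^sub>R (\<xi> + \<eta>)))\<^sup>2 = (norm (\<xi> + \<eta>))\<^sup>2 * s\<^sup>2"
    by (simp add: power_mult_distrib mult.commute)
  \<comment> \<open>For unit vectors the inner product of \<open>\<xi> + \<eta>\<close> with \<xi>,
    and likewise with \<eta>, is half of \<open>(norm (\<xi> + \<eta>))\<^sup>2\<close>.\<close>
  show "(norm (s *\<^sub>R (\<xi> + \<eta>) + h *\<^sub>R \<xi>))\<^sup>2 = (norm (\<xi> + \<eta>))\<^sup>2 * (s * (s + h)) + h\<^sup>2"
    "(norm (s *\<^sub>R (\<xi> + \<eta>) + h *\<^sub>R \<eta>))\<^sup>2 = (norm (\<xi> + \<eta>))\<^sup>2 * (s * (s + h)) + h\<^sup>2"
    unfolding power2_norm_eq_inner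
    by (simp_all add: inner_add_left inner_add_right inner_commute i algebra_simps power2_eq_square)
  have "norm (\<xi> + \<eta>) \<le> 2" using norm_triangle_ineq[of \<xi> \<eta>] assms by simp
  then have "(norm (\<xi> + \<eta>))\<^sup>2 \<le> 2\<^sup>2" by (intro power_mono) auto
  then show "(norm (\<xi> + \<eta>))\<^sup>2 \<le> 4" by simp
qed

text \<open>Integrating over \<eta> costs the total mass \<open>4 * pi\<close>, and
  \<open>s powr (1 - 2 * \<theta>)\<close> is integrable at 0 because
  \<open>\<theta> < 1\<close>.\<close>

lemma nn_integral_cone_powr:
  assumes "0 \<le> T" "0 \<le> A" "\<theta> < 1"
    and F0: "\<And>\<eta> \<xi>. F 0 \<eta> \<xi> = 0"
    and F: "\<And>s \<eta>. 0 < s \<Longrightarrow> s \<le> T \<Longrightarrow> norm \<eta> = 1 \<Longrightarrow> (\<integral>\<^sup>+\<xi>. F s \<eta> \<xi> \<partial>sphere_measure) \<le> ennreal (A * s powr (1 - 2 * \<theta>))"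
  shows "(\<integral>\<^sup>+s\<in>{0..T}. (\<integral>\<^sup>+\<eta>. (\<integral>\<^sup>+\<xi>. F s \<eta> \<xi> \<partial>sphere_measure) \<partial>sphere_measure) \<partial>lborel)
    \<le> ennreal (4 * pi * A * (T powr (2 - 2 * \<theta>) / (2 - 2 * \<theta>)))"
proof -
  have "(\<integral>\<^sup>+s\<in>{0..T}. (\<integral>\<^sup>+\<eta>. (\<integral>\<^sup>+\<xi>. F s \<eta> \<xi> \<partial>sphere_measure) \<partial>sphere_measure) \<partial>lborel)
      \<le> (\<integral>\<^sup>+s. ennreal (4 * pi * A) * (ennreal (s powr (1 - 2 * \<theta>)) * indicator {0..T} s) \<partial>lborel)"
  proof (rule nn_integral_mono)
    fix s :: real
    show "(\<integral>\<^sup>+\<eta>. (\<integral>\<^sup>+\<xi>. F s \<eta> \<xi> \<partial>sphere_measure) \<partial>sphere_measure) * indicator {0..T} s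
      \<le> ennreal (4 * pi * A) * (ennreal (s powr (1 - 2 * \<theta>)) * indicator {0..T} s)"
    proof (cases "0 < s \<and> s \<le> T")
      case True
      have "(\<integral>\<^sup>+\<eta>. (\<integral>\<^sup>+\<xi>. F s \<eta> \<xi> \<partial>sphere_measure) \<partial>sphere_measure)
          \<le> (\<integral>\<^sup>+\<eta>. ennreal (A * s powr (1 - 2 * \<theta>)) \<partial>sphere_measure)"
        using True by (intro nn_integral_mono F) auto
      also have "\<dots> = ennreal (4 * pi * A) * ennreal (s powr (1 - 2 * \<theta>))"
        using \<open>0 \<le> A\<close> by (simp add: emeasure_sphere_measure ennreal_mult[symmetric] mult_ac)
      finally show ?thesis using True by simp
    next
      case False
      \<comment> \<open>At \<open>s = 0\<close> the convention \<open>0 powr x = 0\<close> makes the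
        right side vanish, so \<open>F 0\<close> has to vanish too; the weight \<open>s\<close> or
        \<open>s\<^sup>2\<close> ensures this.\<close>
      then show ?thesis by (cases "s = 0") (auto simp: F0 indicator_def)
    qed
  qed
  also have "\<dots> = ennreal (4 * pi * A) * (\<integral>\<^sup>+s\<in>{0..T}. ennreal (s powr (1 - 2 * \<theta>)) \<partial>lborel)"
    by (rule nn_integral_cmult) measurable
  also have "(\<integral>\<^sup>+s\<in>{0..T}. ennreal (s powr (1 - 2 * \<theta>)) \<partial>lborel) = ennreal (T powr (2 - 2 * \<theta>) / (2 - 2 * \<theta>))"
    using has_integral_powr_from_0[of "1 - 2 * \<theta>" T] assms
    by (intro nn_integral_has_integral_lebesgue') auto
  finally show ?thesis using assms by (simp add: ennreal_mult[symmetric])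
qed

text \<open>One slice at fixed \<open>s\<close> and \<eta>. The sphere estimate yields
  \<open>(a * s\<^sup>2 / 2) powr (- \<theta>)\<close>, whose power of \<open>a\<close> goes into
  the Gamma integral, while \<open>s powr (- 2 * \<theta>)\<close> is left for the radial
  integral.\<close>

lemma bessel_kernel_sphere_integral:
  assumes "1 < \<alpha>" and \<eta>: "norm \<eta> = 1" and pos: "0 < s" "0 \<le> c" "0 < h" "0 \<le> K" "0 \<le> \<theta>" "\<theta> \<le> 1"
    and p: "0 < \<theta> - \<rho> / 2 + (\<alpha> - 3) / 2"
    and meas [measurable]: "(\<lambda>(\<xi>, w). D \<xi> w) \<in> borel_measurable (sphere_measure \<Otimes>\<^sub>M lborel)"
    and L: "\<And>\<xi>. norm \<xi> = 1 \<Longrightarrow> \<xi> + \<eta> \<noteq> 0 \<Longrightarrow> has_bochner_integral lborel (\<lambda>w. bessel_weight \<alpha> w * D \<xi> w) (L \<xi>)"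
    and D: "\<And>w \<xi>. 0 < w \<Longrightarrow> norm \<xi> = 1 \<Longrightarrow>
      \<bar>D \<xi> w\<bar> \<le> K * (sqrt (1 / (4 * w)) * h) powr \<rho> * exp (- (1 / (4 * w) * s\<^sup>2 / 2 * (norm (\<xi> + \<eta>))\<^sup>2))"
  shows "(\<integral>\<^sup>+\<xi>. ennreal (\<bar>L \<xi>\<bar> * c) \<partial>sphere_measure)
    \<le> ennreal (K * (12 * exp 1 * pi * sqrt pi) * 4 powr (\<theta> - \<rho> / 2) * 2 powr \<theta> * c * s powr (- 2 * \<theta>) * h powr \<rho>
        * Gamma (\<theta> - \<rho> / 2 + (\<alpha> - 3) / 2))"
proof (rule nn_integral_bessel_mixture)
  show "sigma_finite_measure sphere_measure"
    using finite_measure_sphere_measure by (simp add: finite_measure_def)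
  show "(\<lambda>(\<xi>, w). ennreal (\<bar>D \<xi> w\<bar> * c)) \<in> borel_measurable (sphere_measure \<Otimes>\<^sub>M lborel)"
    by measurable
  show "AE \<xi> in sphere_measure. ennreal (\<bar>L \<xi>\<bar> * c) \<le> (\<integral>\<^sup>+w. ennreal (bessel_weight \<alpha> w) * ennreal (\<bar>D \<xi> w\<bar> * c) \<partial>lborel)"
    using AE_sphere_measure_add_neq_0[OF \<eta>] AE_space[of sphere_measure]
    by eventually_elim (use \<open>0 \<le> c\<close> in \<open>auto intro!: abs_le_nn_integral_bessel_weight L\<close>)
  let ?K0 = "12 * exp 1 * pi * sqrt pi :: real"
  fix w :: real assume w: "0 < w"
  define a where "a = 1 / (4 * w)"
  have a: "0 < a" using w by (simp add: a_def)
  let ?t = "(sqrt a * h) powr \<rho>"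
  have "(\<integral>\<^sup>+\<xi>. ennreal (\<bar>D \<xi> w\<bar> * c) \<partial>sphere_measure)
      \<le> (\<integral>\<^sup>+\<xi>. ennreal (K * ?t * c) * ennreal (exp (- (a * s\<^sup>2 / 2 * (norm (\<xi> + \<eta>))\<^sup>2))) \<partial>sphere_measure)"
  proof (rule nn_integral_mono)
    fix \<xi> assume "\<xi> \<in> space sphere_measure"
    then have "\<bar>D \<xi> w\<bar> * c \<le> K * ?t * exp (- (a * s\<^sup>2 / 2 * (norm (\<xi> + \<eta>))\<^sup>2)) * c"
      unfolding a_def using D[OF w] \<open>0 \<le> c\<close> by (intro mult_right_mono) auto
    then show "ennreal (\<bar>D \<xi> w\<bar> * c) \<le> ennreal (K * ?t * c) * ennreal (exp (- (a * s\<^sup>2 / 2 * (norm (\<xi> + \<eta>))\<^sup>2)))"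
      using \<open>0 \<le> c\<close> \<open>0 \<le> K\<close> by (simp add: ennreal_mult[symmetric] ennreal_leI mult_ac)
  qed
  also have "\<dots> = ennreal (K * ?t * c) * (\<integral>\<^sup>+\<xi>. ennreal (exp (- (a * s\<^sup>2 / 2 * (norm (\<xi> + \<eta>))\<^sup>2))) \<partial>sphere_measure)"
    by (rule nn_integral_cmult) measurable
  also have "\<dots> \<le> ennreal (K * ?t * c) * ennreal (?K0 * (a * s\<^sup>2 / 2) powr (- \<theta>))"
    using a pos by (intro mult_left_mono nn_integral_sphere_gaussian \<eta>) auto
  also have "\<dots> = ennreal (K * ?K0 * c * (a * s\<^sup>2 / 2) powr (- \<theta>) * ?t)"
    using pos by (subst ennreal_mult[symmetric]) (auto simp: mult_ac)
  also have "(a * s\<^sup>2 / 2) powr (- \<theta>) = a powr (- \<theta>) * s powr (- 2 * \<theta>) * 2 powr \<theta>"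
    using a pos by (simp add: powr_mult powr_divide powr_minus_divide powr_powr flip: powr_numeral)
  also have "K * ?K0 * c * (a powr (- \<theta>) * s powr (- 2 * \<theta>) * 2 powr \<theta>) * ?t
      = K * ?K0 * c * s powr (- 2 * \<theta>) * 2 powr \<theta> * (?t * a powr (- \<theta>))"
    by (simp only: mult_ac)
  also have "?t * a powr (- \<theta>) = 4 powr (\<theta> - \<rho> / 2) * h powr \<rho> * w powr (\<theta> - \<rho> / 2)"
    unfolding a_def by (rule powr_scale) (use w pos in auto)
  finally show "(\<integral>\<^sup>+\<xi>. ennreal (\<bar>D \<xi> w\<bar> * c) \<partial>sphere_measure)
      \<le> ennreal (K * ?K0 * 4 powr (\<theta> - \<rho> / 2) * 2 powr \<theta> * c * s powr (- 2 * \<theta>) * h powr \<rho> * w powr (\<theta> - \<rho> / 2))"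
    by (simp only: mult_ac)
qed (use pos p in auto)

text \<open>Convergence in \<open>w\<close> asks for
  \<open>\<theta> > 1 - (\<alpha> - 1 - \<rho>) / 2\<close> and convergence in \<open>s\<close> for
  \<open>\<theta> < 1\<close>. The witness is the midpoint of these bounds, raised to 0 when
  negative because the sphere estimate needs \<open>0 \<le> \<theta>\<close>.\<close>

lemma cone_exponent:
  assumes "0 < \<rho>" "\<rho> < \<alpha> - 1"
  obtains \<theta> :: real where "0 \<le> \<theta>" "\<theta> < 1" "0 < \<theta> - \<rho> / 2 + (\<alpha> - 3) / 2"
proof
  let ?\<theta> = "max 0 (1 - (\<alpha> - 1 - \<rho>) / 4)"
  show "0 \<le> ?\<theta>" "?\<theta> < 1" using assms by auto
  have "1 - (\<alpha> - 1 - \<rho>) / 4 \<le> ?\<theta>" by simp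
  then show "0 < ?\<theta> - \<rho> / 2 + (\<alpha> - 3) / 2" using assms by (simp add: field_simps del: max.cobounded2)
qed

lemma bessel_kernel_cone_first_difference:
  assumes "1 < \<alpha>" "0 < \<rho>" "\<rho> < \<alpha> - 1" "\<rho> \<le> 1" "0 < T"
  shows "\<exists>C\<ge>0. \<forall>h>0.
    (\<integral>\<^sup>+s\<in>{0..T}. (\<integral>\<^sup>+\<eta>. (\<integral>\<^sup>+\<xi>.
        ennreal (\<bar>bessel_kernel \<alpha> (s *\<^sub>R (\<xi> + \<eta>) + h *\<^sub>R (\<xi> + \<eta>)) - bessel_kernel \<alpha> (s *\<^sub>R (\<xi> + \<eta>) + h *\<^sub>R \<eta>)\<bar> * s)
      \<partial>sphere_measure) \<partial>sphere_measure) \<partial>lborel) \<le> ennreal (C * h powr \<rho>)"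
proof -
  obtain \<theta> where \<theta>: "0 \<le> \<theta>" "\<theta> < 1" and p: "0 < \<theta> - \<rho> / 2 + (\<alpha> - 3) / 2"
    using assms by (auto intro: cone_exponent)
  define G where "G = 7 * (12 * exp 1 * pi * sqrt pi) * 4 powr (\<theta> - \<rho> / 2) * 2 powr \<theta> * Gamma (\<theta> - \<rho> / 2 + (\<alpha> - 3) / 2)"
  have G: "0 \<le> G" using p by (simp add: G_def Gamma_real_pos less_imp_le)
  let ?E = "\<lambda>w z. exp (- (1 / (4 * w) * (norm (z :: real^3))\<^sup>2))"
  have "(\<integral>\<^sup>+s\<in>{0..T}. (\<integral>\<^sup>+\<eta>. (\<integral>\<^sup>+\<xi>.
        ennreal (\<bar>bessel_kernel \<alpha> (s *\<^sub>R (\<xi> + \<eta>) + h *\<^sub>R (\<xi> + \<eta>)) - bessel_kernel \<alpha> (s *\<^sub>R (\<xi> + \<eta>) + h *\<^sub>R \<eta>)\<bar> * s)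
      \<partial>sphere_measure) \<partial>sphere_measure) \<partial>lborel)
      \<le> ennreal (4 * pi * (G * h powr \<rho>) * (T powr (2 - 2 * \<theta>) / (2 - 2 * \<theta>)))" if h: "0 < h" for h
  proof (rule nn_integral_cone_powr)
    fix s :: real and \<eta> :: "real^3" assume s: "0 < s" and \<eta>: "norm \<eta> = 1"
    have "(\<integral>\<^sup>+\<xi>. ennreal (\<bar>bessel_kernel \<alpha> (s *\<^sub>R (\<xi> + \<eta>) + h *\<^sub>R (\<xi> + \<eta>)) - bessel_kernel \<alpha> (s *\<^sub>R (\<xi> + \<eta>) + h *\<^sub>R \<eta>)\<bar> * s) \<partial>sphere_measure)
      \<le> ennreal (7 * (12 * exp 1 * pi * sqrt pi) * 4 powr (\<theta> - \<rho> / 2) * 2 powr \<theta> * s * s powr (- 2 * \<theta>) * h powr \<rho>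
        * Gamma (\<theta> - \<rho> / 2 + (\<alpha> - 3) / 2))"
    proof (rule bessel_kernel_sphere_integral[OF \<open>1 < \<alpha>\<close> \<eta> s, where
          D = "\<lambda>\<xi> w. ?E w (s *\<^sub>R (\<xi> + \<eta>) + h *\<^sub>R (\<xi> + \<eta>)) - ?E w (s *\<^sub>R (\<xi> + \<eta>) + h *\<^sub>R \<eta>)"])
      fix \<xi> :: "real^3" assume \<xi>: "norm \<xi> = 1" "\<xi> + \<eta> \<noteq> 0"
      \<comment> \<open>Away from the antipode \<open>\<xi> = - \<eta>\<close> the points stay off
        the origin, so the mixture formula applies.\<close>
      have "0 < (norm (\<xi> + \<eta>))\<^sup>2" using \<xi> by simp
      then have "0 < (norm (s *\<^sub>R (\<xi> + \<eta>) + h *\<^sub>R (\<xi> + \<eta>)))\<^sup>2" "0 < (norm (s *\<^sub>R (\<xi> + \<eta>) + h *\<^sub>R \<eta>))\<^sup>2"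
        unfolding norm_cone_points[OF \<xi>(1) \<eta>] using s h by (auto intro!: mult_pos_pos add_pos_pos)
      then have ne: "s *\<^sub>R (\<xi> + \<eta>) + h *\<^sub>R (\<xi> + \<eta>) \<noteq> 0" "s *\<^sub>R (\<xi> + \<eta>) + h *\<^sub>R \<eta> \<noteq> 0"
        by force+
      show "has_bochner_integral lborel (\<lambda>w. bessel_weight \<alpha> w *
            (?E w (s *\<^sub>R (\<xi> + \<eta>) + h *\<^sub>R (\<xi> + \<eta>)) - ?E w (s *\<^sub>R (\<xi> + \<eta>) + h *\<^sub>R \<eta>)))
          (bessel_kernel \<alpha> (s *\<^sub>R (\<xi> + \<eta>) + h *\<^sub>R (\<xi> + \<eta>)) - bessel_kernel \<alpha> (s *\<^sub>R (\<xi> + \<eta>) + h *\<^sub>R \<eta>))"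
        unfolding right_diff_distrib
        by (intro has_bochner_integral_diff has_bochner_integral_bessel_kernel ne \<open>1 < \<alpha>\<close>)
    next
      fix w :: real and \<xi> :: "real^3" assume "0 < w" and \<xi>: "norm \<xi> = 1"
      then show "\<bar>?E w (s *\<^sub>R (\<xi> + \<eta>) + h *\<^sub>R (\<xi> + \<eta>)) - ?E w (s *\<^sub>R (\<xi> + \<eta>) + h *\<^sub>R \<eta>)\<bar>
        \<le> 7 * (sqrt (1 / (4 * w)) * h) powr \<rho> * exp (- (1 / (4 * w) * s\<^sup>2 / 2 * (norm (\<xi> + \<eta>))\<^sup>2))"
        unfolding norm_cone_points[OF \<xi> \<eta>]
        by (intro cone_first_difference norm_cone_points(5)[OF \<xi> \<eta>]) (use s h assms in auto)
    qed (use s h \<theta> p in \<open>auto | measurable\<close>)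
    \<comment> \<open>The weight \<open>s\<close> against \<open>s powr (- 2 * \<theta>)\<close>
      leaves the exponent \<open>1 - 2 * \<theta>\<close>, which exceeds -1.\<close>
    also have "7 * (12 * exp 1 * pi * sqrt pi) * 4 powr (\<theta> - \<rho> / 2) * 2 powr \<theta> * s * s powr (- 2 * \<theta>) * h powr \<rho>
        * Gamma (\<theta> - \<rho> / 2 + (\<alpha> - 3) / 2) = G * h powr \<rho> * (s powr 1 * s powr (- 2 * \<theta>))"
      using s by (simp add: G_def mult_ac)
    also have "s powr 1 * s powr (- 2 * \<theta>) = s powr (1 - 2 * \<theta>)"
      unfolding powr_add[symmetric] by simp
    finally show "(\<integral>\<^sup>+\<xi>. ennreal (\<bar>bessel_kernel \<alpha> (s *\<^sub>R (\<xi> + \<eta>) + h *\<^sub>R (\<xi> + \<eta>)) - bessel_kernel \<alpha> (s *\<^sub>R (\<xi> + \<eta>) + h *\<^sub>R \<eta>)\<bar> * s) \<partial>sphere_measure)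
      \<le> ennreal (G * h powr \<rho> * s powr (1 - 2 * \<theta>))" .
  qed (use assms G \<theta> h in auto)
  moreover have "0 \<le> 4 * pi * G * (T powr (2 - 2 * \<theta>) / (2 - 2 * \<theta>))" using G \<theta> by simp
  ultimately show ?thesis
    by (intro exI[of _ "4 * pi * G * (T powr (2 - 2 * \<theta>) / (2 - 2 * \<theta>))"]) (simp add: mult_ac)
qed

lemma bessel_kernel_cone_second_difference:
  assumes "1 < \<alpha>" "0 < \<rho>" "\<rho> < \<alpha> - 1" "\<rho> \<le> 2" "0 < T"
  shows "\<exists>C\<ge>0. \<forall>h>0.
    (\<integral>\<^sup>+s\<in>{0..T}. (\<integral>\<^sup>+\<eta>. (\<integral>\<^sup>+\<xi>.
        ennreal (\<bar>bessel_kernel \<alpha> (s *\<^sub>R (\<xi> + \<eta>) + h *\<^sub>R (\<xi> + \<eta>)) - bessel_kernel \<alpha> (s *\<^sub>R (\<xi> + \<eta>) + h *\<^sub>R \<xi>)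
          - bessel_kernel \<alpha> (s *\<^sub>R (\<xi> + \<eta>) + h *\<^sub>R \<eta>) + bessel_kernel \<alpha> (s *\<^sub>R (\<xi> + \<eta>))\<bar> * s\<^sup>2)
      \<partial>sphere_measure) \<partial>sphere_measure) \<partial>lborel) \<le> ennreal (C * h powr \<rho>)"
proof -
  obtain \<theta> where \<theta>: "0 \<le> \<theta>" "\<theta> < 1" and p: "0 < \<theta> - \<rho> / 2 + (\<alpha> - 3) / 2"
    using assms by (auto intro: cone_exponent)
  define G where "G = 96 * (12 * exp 1 * pi * sqrt pi) * 4 powr (\<theta> - \<rho> / 2) * 2 powr \<theta> * Gamma (\<theta> - \<rho> / 2 + (\<alpha> - 3) / 2)"
  have G: "0 \<le> G" using p by (simp add: G_def Gamma_real_pos less_imp_le)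
  let ?E = "\<lambda>w z. exp (- (1 / (4 * w) * (norm (z :: real^3))\<^sup>2))"
  let ?L = "\<lambda>h s \<eta> \<xi>. bessel_kernel \<alpha> (s *\<^sub>R (\<xi> + \<eta>) + h *\<^sub>R (\<xi> + \<eta>)) - bessel_kernel \<alpha> (s *\<^sub>R (\<xi> + \<eta>) + h *\<^sub>R \<xi>)
          - bessel_kernel \<alpha> (s *\<^sub>R (\<xi> + \<eta>) + h *\<^sub>R \<eta>) + bessel_kernel \<alpha> (s *\<^sub>R (\<xi> + \<eta>))"
  have "(\<integral>\<^sup>+s\<in>{0..T}. (\<integral>\<^sup>+\<eta>. (\<integral>\<^sup>+\<xi>. ennreal (\<bar>?L h s \<eta> \<xi>\<bar> * s\<^sup>2)
      \<partial>sphere_measure) \<partial>sphere_measure) \<partial>lborel)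
      \<le> ennreal (4 * pi * (G * T * h powr \<rho>) * (T powr (2 - 2 * \<theta>) / (2 - 2 * \<theta>)))" if h: "0 < h" for h
  proof (rule nn_integral_cone_powr)
    let ?D = "\<lambda>s \<eta> \<xi> w. ?E w (s *\<^sub>R (\<xi> + \<eta>) + h *\<^sub>R (\<xi> + \<eta>)) - ?E w (s *\<^sub>R (\<xi> + \<eta>) + h *\<^sub>R \<xi>)
          - ?E w (s *\<^sub>R (\<xi> + \<eta>) + h *\<^sub>R \<eta>) + ?E w (s *\<^sub>R (\<xi> + \<eta>))"
    fix s :: real and \<eta> :: "real^3" assume s: "0 < s" "s \<le> T" and \<eta>: "norm \<eta> = 1"
    have "(\<integral>\<^sup>+\<xi>. ennreal (\<bar>?L h s \<eta> \<xi>\<bar> * s\<^sup>2) \<partial>sphere_measure)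
      \<le> ennreal (96 * (12 * exp 1 * pi * sqrt pi) * 4 powr (\<theta> - \<rho> / 2) * 2 powr \<theta> * s\<^sup>2 * s powr (- 2 * \<theta>) * h powr \<rho>
        * Gamma (\<theta> - \<rho> / 2 + (\<alpha> - 3) / 2))"
    proof (rule bessel_kernel_sphere_integral[OF \<open>1 < \<alpha>\<close> \<eta> s(1), where D = "?D s \<eta>"])
      fix \<xi> :: "real^3" assume \<xi>: "norm \<xi> = 1" "\<xi> + \<eta> \<noteq> 0"
      have "0 < (norm (\<xi> + \<eta>))\<^sup>2" using \<xi> by simp
      then have "0 < (norm (s *\<^sub>R (\<xi> + \<eta>) + h *\<^sub>R (\<xi> + \<eta>)))\<^sup>2" "0 < (norm (s *\<^sub>R (\<xi> + \<eta>) + h *\<^sub>R \<xi>))\<^sup>2"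
        "0 < (norm (s *\<^sub>R (\<xi> + \<eta>) + h *\<^sub>R \<eta>))\<^sup>2" "0 < (norm (s *\<^sub>R (\<xi> + \<eta>)))\<^sup>2"
        unfolding norm_cone_points[OF \<xi>(1) \<eta>] using s h by (auto intro!: mult_pos_pos add_pos_pos)
      then have ne: "s *\<^sub>R (\<xi> + \<eta>) + h *\<^sub>R (\<xi> + \<eta>) \<noteq> 0" "s *\<^sub>R (\<xi> + \<eta>) + h *\<^sub>R \<xi> \<noteq> 0"
        "s *\<^sub>R (\<xi> + \<eta>) + h *\<^sub>R \<eta> \<noteq> 0" "s *\<^sub>R (\<xi> + \<eta>) \<noteq> 0"
        by force+
      show "has_bochner_integral lborel (\<lambda>w. bessel_weight \<alpha> w * ?D s \<eta> \<xi> w) (?L h s \<eta> \<xi>)"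
        unfolding right_diff_distrib distrib_left
        by (intro has_bochner_integral_add has_bochner_integral_diff has_bochner_integral_bessel_kernel ne \<open>1 < \<alpha>\<close>)
    next
      fix w :: real and \<xi> :: "real^3" assume w: "0 < w" and \<xi>: "norm \<xi> = 1"
      \<comment> \<open>The two middle points have equal norms, so four terms become the three of
        \<open>cone_second_difference\<close>.\<close>
      have "?D s \<eta> \<xi> w = exp (- (1 / (4 * w) * ((norm (\<xi> + \<eta>))\<^sup>2 * (s + h)\<^sup>2)))
          - 2 * exp (- (1 / (4 * w) * ((norm (\<xi> + \<eta>))\<^sup>2 * (s * (s + h)) + h\<^sup>2)))
          + exp (- (1 / (4 * w) * ((norm (\<xi> + \<eta>))\<^sup>2 * s\<^sup>2)))"
        unfolding norm_cone_points[OF \<xi> \<eta>] by simp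
      also have "\<bar>\<dots>\<bar> \<le> 96 * (sqrt (1 / (4 * w)) * h) powr \<rho> * exp (- (1 / (4 * w) * s\<^sup>2 / 2 * (norm (\<xi> + \<eta>))\<^sup>2))"
        by (intro cone_second_difference norm_cone_points(5)[OF \<xi> \<eta>]) (use w s h assms in auto)
      finally show "\<bar>?D s \<eta> \<xi> w\<bar>
        \<le> 96 * (sqrt (1 / (4 * w)) * h) powr \<rho> * exp (- (1 / (4 * w) * s\<^sup>2 / 2 * (norm (\<xi> + \<eta>))\<^sup>2))" .
    qed (use s h \<theta> p in \<open>auto | measurable\<close>)
    also have "96 * (12 * exp 1 * pi * sqrt pi) * 4 powr (\<theta> - \<rho> / 2) * 2 powr \<theta> * s\<^sup>2 * s powr (- 2 * \<theta>) * h powr \<rho>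
        * Gamma (\<theta> - \<rho> / 2 + (\<alpha> - 3) / 2) = G * s * h powr \<rho> * (s powr 1 * s powr (- 2 * \<theta>))"
      using s by (simp add: G_def power2_eq_square)
    also have "s powr 1 * s powr (- 2 * \<theta>) = s powr (1 - 2 * \<theta>)"
      unfolding powr_add[symmetric] by simp
    \<comment> \<open>One factor of the weight \<open>s\<^sup>2\<close> is bounded by
      \<open>T\<close>, which brings the radial integral to the form used for the first
      difference.\<close>
    also have "G * s * h powr \<rho> * s powr (1 - 2 * \<theta>) \<le> G * T * h powr \<rho> * s powr (1 - 2 * \<theta>)"
      using s G by (intro mult_right_mono mult_left_mono) auto
    finally show "(\<integral>\<^sup>+\<xi>. ennreal (\<bar>?L h s \<eta> \<xi>\<bar> * s\<^sup>2) \<partial>sphere_measure)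
      \<le> ennreal (G * T * h powr \<rho> * s powr (1 - 2 * \<theta>))" by (simp add: ennreal_leI)
  qed (use assms G \<theta> h in auto)
  moreover have "0 \<le> 4 * pi * G * T * (T powr (2 - 2 * \<theta>) / (2 - 2 * \<theta>))" using G \<theta> assms by simp
  ultimately show ?thesis
    by (intro exI[of _ "4 * pi * G * T * (T powr (2 - 2 * \<theta>) / (2 - 2 * \<theta>))"]) (simp add: mult_ac)
qed

section \<open>Assembly of the bounds with one common constant\<close>

theorem proposition5p3:
  fixes T \<alpha> :: real and f :: "real^3 \<Rightarrow> real"
  assumes "T > 0" and "\<alpha> > 1" and f_def: "f = bessel_kernel \<alpha>"
  shows "(\<integral>\<^sup>+x\<in>cball 0 1. ennreal (f x / norm x) \<partial>lborel) < \<infinity>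
    \<and> (\<forall>\<gamma> \<rho>1 \<nu> \<gamma>' \<rho>2 :: real.
        0 < \<gamma> \<and> \<gamma> < min (\<alpha> - 1) 1 \<and>
        0 < \<rho>1 \<and> \<rho>1 < min (\<alpha> - 1) 1 \<and>
        0 < \<nu> \<and> \<nu> < min (\<alpha> - 1) 1 \<and>
        0 < \<gamma>' \<and> \<gamma>' < min (\<alpha> - 1) 2 \<and>
        0 < \<rho>2 \<and> \<rho>2 < min (\<alpha> - 1) 2 \<longrightarrow>
        (\<exists>C :: real.
          (\<forall>y :: real^3.
            (\<integral>\<^sup>+z\<in>cball 0 (2 * T). ennreal (\<bar>f (z + y) - f z\<bar> / norm z) \<partial>lborel)
              \<le> ennreal (C * norm y powr \<gamma>)) \<and>
          (\<forall>y :: real^3.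
            (\<integral>\<^sup>+z\<in>cball 0 (2 * T). ennreal (\<bar>f (z + y) + f (z - y) - 2 * f z\<bar> / norm z) \<partial>lborel)
              \<le> ennreal (C * norm y powr \<gamma>')) \<and>
          (\<forall>h :: real. 0 < h \<and> h \<le> 2 * T \<longrightarrow>
            (\<integral>\<^sup>+z\<in>cball 0 h. ennreal (f z / norm z) \<partial>lborel) \<le> ennreal (C * h powr \<nu>)) \<and>
          (\<forall>h :: real. 0 < h \<and> h \<le> 1 \<longrightarrow>
            (\<integral>\<^sup>+s\<in>{0..T}. (\<integral>\<^sup>+\<eta>. (\<integral>\<^sup>+\<xi>.
                ennreal (\<bar>f (s *\<^sub>R (\<xi> + \<eta>) + h *\<^sub>R (\<xi> + \<eta>)) - f (s *\<^sub>R (\<xi> + \<eta>) + h *\<^sub>R \<eta>)\<bar> * s)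
              \<partial>sphere_measure) \<partial>sphere_measure) \<partial>lborel)
              \<le> ennreal (C * h powr \<rho>1)) \<and>
          (\<forall>h :: real. 0 < h \<and> h \<le> 1 \<longrightarrow>
            (\<integral>\<^sup>+s\<in>{0..T}. (\<integral>\<^sup>+\<eta>. (\<integral>\<^sup>+\<xi>.
                ennreal (\<bar>f (s *\<^sub>R (\<xi> + \<eta>) + h *\<^sub>R (\<xi> + \<eta>)) - f (s *\<^sub>R (\<xi> + \<eta>) + h *\<^sub>R \<xi>)
                          - f (s *\<^sub>R (\<xi> + \<eta>) + h *\<^sub>R \<eta>) + f (s *\<^sub>R (\<xi> + \<eta>))\<bar> * s\<^sup>2)
              \<partial>sphere_measure) \<partial>sphere_measure) \<partial>lborel)
              \<le> ennreal (C * h powr \<rho>2))))"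
proof (intro conjI allI impI)
  note cball_bound = bessel_kernel_over_norm_cball[OF \<open>\<alpha> > 1\<close>, folded f_def]
  \<comment> \<open>Any admissible exponent would do for finiteness; half of the upper bound is one,
    and the radius is 1.\<close>
  have "0 < min (\<alpha> - 1) 1 / 2" "min (\<alpha> - 1) 1 / 2 < \<alpha> - 1" "min (\<alpha> - 1) 1 / 2 \<le> 2"
    using \<open>\<alpha> > 1\<close> by (auto simp: min_def)
  from cball_bound[OF this] obtain C where
    "(\<integral>\<^sup>+x\<in>cball 0 1. ennreal (f x / norm x) \<partial>lborel) \<le> ennreal (C * 1 powr (min (\<alpha> - 1) 1 / 2))"
    by (metis zero_less_one)
  also have "\<dots> < \<infinity>" by simp
  finally show "(\<integral>\<^sup>+x\<in>cball 0 1. ennreal (f x / norm x) \<partial>lborel) < \<infinity>" .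
next
  fix \<gamma> \<rho>1 \<nu> \<gamma>' \<rho>2 :: real
  assume e: "0 < \<gamma> \<and> \<gamma> < min (\<alpha> - 1) 1 \<and> 0 < \<rho>1 \<and> \<rho>1 < min (\<alpha> - 1) 1 \<and> 0 < \<nu> \<and> \<nu> < min (\<alpha> - 1) 1 \<and>
    0 < \<gamma>' \<and> \<gamma>' < min (\<alpha> - 1) 2 \<and> 0 < \<rho>2 \<and> \<rho>2 < min (\<alpha> - 1) 2"
  have restrict: "(\<integral>\<^sup>+z\<in>A. g z \<partial>lborel) \<le> (\<integral>\<^sup>+z. g z \<partial>lborel)" for A and g :: "real^3 \<Rightarrow> ennreal"
    by (intro nn_integral_mono) (simp add: indicator_def)
  obtain C1 where C1: "C1 \<ge> 0" "\<And>y. (\<integral>\<^sup>+z. ennreal (\<bar>f (z + y) - f z\<bar> / norm z) \<partial>lborel) \<le> ennreal (C1 * norm y powr \<gamma>)"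
    using bessel_kernel_first_difference[OF \<open>\<alpha> > 1\<close>, of \<gamma>] e unfolding f_def by auto
  obtain C2 where C2: "C2 \<ge> 0" "\<And>y. (\<integral>\<^sup>+z. ennreal (\<bar>f (z + y) + f (z - y) - 2 * f z\<bar> / norm z) \<partial>lborel) \<le> ennreal (C2 * norm y powr \<gamma>')"
    using bessel_kernel_second_difference[OF \<open>\<alpha> > 1\<close>, of \<gamma>'] e unfolding f_def by auto
  obtain C3 where C3: "C3 \<ge> 0" "\<And>h. 0 < h \<Longrightarrow> (\<integral>\<^sup>+z\<in>cball 0 h. ennreal (f z / norm z) \<partial>lborel) \<le> ennreal (C3 * h powr \<nu>)"
    using bessel_kernel_over_norm_cball[OF \<open>\<alpha> > 1\<close>, of \<nu>] e unfolding f_def by auto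
  let ?I4 = "\<lambda>h. \<integral>\<^sup>+s\<in>{0..T}. (\<integral>\<^sup>+\<eta>. (\<integral>\<^sup>+\<xi>.
      ennreal (\<bar>f (s *\<^sub>R (\<xi> + \<eta>) + h *\<^sub>R (\<xi> + \<eta>)) - f (s *\<^sub>R (\<xi> + \<eta>) + h *\<^sub>R \<eta>)\<bar> * s)
    \<partial>sphere_measure) \<partial>sphere_measure) \<partial>lborel"
  obtain C4 where C4: "C4 \<ge> 0" "\<And>h. 0 < h \<Longrightarrow> ?I4 h \<le> ennreal (C4 * h powr \<rho>1)"
    using bessel_kernel_cone_first_difference[OF \<open>\<alpha> > 1\<close>, of \<rho>1 T] e \<open>T > 0\<close> unfolding f_def by auto
  let ?I5 = "\<lambda>h. \<integral>\<^sup>+s\<in>{0..T}. (\<integral>\<^sup>+\<eta>. (\<integral>\<^sup>+\<xi>.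
      ennreal (\<bar>f (s *\<^sub>R (\<xi> + \<eta>) + h *\<^sub>R (\<xi> + \<eta>)) - f (s *\<^sub>R (\<xi> + \<eta>) + h *\<^sub>R \<xi>)
        - f (s *\<^sub>R (\<xi> + \<eta>) + h *\<^sub>R \<eta>) + f (s *\<^sub>R (\<xi> + \<eta>))\<bar> * s\<^sup>2)
    \<partial>sphere_measure) \<partial>sphere_measure) \<partial>lborel"
  obtain C5 where C5: "C5 \<ge> 0" "\<And>h. 0 < h \<Longrightarrow> ?I5 h \<le> ennreal (C5 * h powr \<rho>2)"
    using bessel_kernel_cone_second_difference[OF \<open>\<alpha> > 1\<close>, of \<rho>2 T] e \<open>T > 0\<close> unfolding f_def by auto
  \<comment> \<open>All five constants are nonnegative, so their sum dominates each of them.\<close>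
  let ?C = "C1 + C2 + C3 + C4 + C5"
  have mono: "I \<le> ennreal (?C * d powr r)" if "I \<le> ennreal (C * d powr r)" "C \<le> ?C" for I C d r
    using that by (elim order_trans) (intro ennreal_leI mult_right_mono, auto)
  show "\<exists>C :: real.
      (\<forall>y. (\<integral>\<^sup>+z\<in>cball 0 (2 * T). ennreal (\<bar>f (z + y) - f z\<bar> / norm z) \<partial>lborel) \<le> ennreal (C * norm y powr \<gamma>)) \<and>
      (\<forall>y. (\<integral>\<^sup>+z\<in>cball 0 (2 * T). ennreal (\<bar>f (z + y) + f (z - y) - 2 * f z\<bar> / norm z) \<partial>lborel)
        \<le> ennreal (C * norm y powr \<gamma>')) \<and>
      (\<forall>h. 0 < h \<and> h \<le> 2 * T \<longrightarrow> (\<integral>\<^sup>+z\<in>cball 0 h. ennreal (f z / norm z) \<partial>lborel) \<le> ennreal (C * h powr \<nu>)) \<and>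
      (\<forall>h. 0 < h \<and> h \<le> 1 \<longrightarrow> ?I4 h \<le> ennreal (C * h powr \<rho>1)) \<and>
      (\<forall>h. 0 < h \<and> h \<le> 1 \<longrightarrow> ?I5 h \<le> ennreal (C * h powr \<rho>2))"
  proof (intro exI[of _ ?C] conjI allI impI)
    show "(\<integral>\<^sup>+z\<in>cball 0 (2 * T). ennreal (\<bar>f (z + y) - f z\<bar> / norm z) \<partial>lborel) \<le> ennreal (?C * norm y powr \<gamma>)" for y
      by (rule order_trans[OF restrict mono[OF C1(2)]]) (use C1 C2 C3 C4 C5 in linarith)
    show "(\<integral>\<^sup>+z\<in>cball 0 (2 * T). ennreal (\<bar>f (z + y) + f (z - y) - 2 * f z\<bar> / norm z) \<partial>lborel)
        \<le> ennreal (?C * norm y powr \<gamma>')" for y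
      by (rule order_trans[OF restrict mono[OF C2(2)]]) (use C1 C2 C3 C4 C5 in linarith)
    show "(\<integral>\<^sup>+z\<in>cball 0 h. ennreal (f z / norm z) \<partial>lborel) \<le> ennreal (?C * h powr \<nu>)" if "0 < h \<and> h \<le> 2 * T" for h
      by (rule mono[OF C3(2)]) (use that C1 C2 C3 C4 C5 in linarith)+
    show "?I4 h \<le> ennreal (?C * h powr \<rho>1)" if "0 < h \<and> h \<le> 1" for h
      by (rule mono[OF C4(2)]) (use that C1 C2 C3 C4 C5 in linarith)+
    show "?I5 h \<le> ennreal (?C * h powr \<rho>2)" if "0 < h \<and> h \<le> 1" for h
      by (rule mono[OF C5(2)]) (use that C1 C2 C3 C4 C5 in linarith)+
  qed
qed

end
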